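(* For every prime number $p$ and all integers $n,k\ge 1$, $$B(p,n,k) \le r_p(k)\left(\frac{p}{2p+2}\,n^2 + n(\log_p n + 1)\right) - n + 1.$$
   Context: For integers $k,n\ge 1$, the generalised symmetric group $C_k \wr S_n$ is regarded as the subgroup of $GL_n(\mathbb{C})$ consisting of the matrices with exactly one non-zero entry in each row and each column, all of whose non-zero entries are $k$-th roots of unity. Its natural representation in characteristic $p$ is the $p$-modular reduction of this $n$-dimensional representation: with $\mathbf{R}$ the ring of algebraic integers in $\mathbb{C}$, $M$ a maximal ideal of $\mathbf{R}$ containing $p$, and $F=\mathbf{R}/M$ (a field of characteristic $p$), it is the representation on $V=F^n$ obtained by reducing the matrix entries modulo $M$. For $r\ge 0$, the Brauer character of $\mathrm{Sym}^r V$ is the complex-valued class function on the set of elements of $C_k\wr S_n$ of order coprime to $p$ (eigenvalues being lifted from $F$ to complex roots of unity of order coprime to $p$ via reduction modulo $M$). Let $B(p,n,k)$ be the dimension of the complex vector space spanned by the Brauer characters of $\mathrm{Sym}^r V$, $r\ge 0$. For a positive integer $k=p^a m$ with $m$ coprime to $p$, define $r_p(k)=m$. Here $\log_p$ is the logarithm to base $p$. *)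

theory Defs
  imports
    Complex_Main
    "HOL-Library.Function_Algebras"
    "HOL-Library.Poly_Mapping"
    "HOL-Algebra.Multiplicative_Group"
    "HOL-Algebra.QuotRing"
    "Jordan_Normal_Form.Char_Poly"
    "Jordan_Normal_Form.VS_Connect"
begin

definition p'_part :: "nat \<Rightarrow> nat \<Rightarrow> nat" where
  "p'_part p k = k div p ^ multiplicity p k"

lemma p'_part_eq:
  assumes "prime p" "k = p ^ a * m" "coprime m p"
  shows "p'_part p k = m"
proof -
  have "m \<noteq> 0"
    using assms(1,3) by (metis coprime_0_left_iff not_prime_unit)
  moreover have "\<not> p dvd m"
    using assms(1,3) by (metis coprime_absorb_right not_prime_unit)
  moreover have "p \<noteq> 0"
    using assms(1) by auto
  moreover have "multiplicity p (p ^ a * m) = a"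
    using calculation assms(1) not_prime_unit by (intro multiplicity_decomposeI) auto
  ultimately show ?thesis
    using assms by (simp add: p'_part_def)
qed


subsection \<open>Reduction modulo a maximal ideal of the ring of algebraic integers\<close>

definition alg_ints :: "complex ring" where
  "alg_ints = \<lparr>carrier = {x. algebraic_int x}, monoid.mult = (*), one = 1, zero = 0, add = (+)\<rparr>"

text \<open>
  The residue field of the maximal ideal \<open>M\<close> is a set of cosets, not a type. It is
  identified with a type \<open>'f\<close> of class \<open>field\<close> by a ring isomorphism \<open>\<phi>\<close> from
  \<open>alg_ints Quot M\<close> onto \<open>'f\<close>; \<open>reduction M \<phi>\<close> is the resulting residue map. It is
  meaningful on algebraic integers only.
\<close>

definition reduction :: "complex set \<Rightarrow> (complex set \<Rightarrow> 'f) \<Rightarrow> complex \<Rightarrow> 'f" where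
  "reduction M \<phi> x = \<phi> (M +>\<^bsub>alg_ints\<^esub> x)"


subsection \<open>Generalised symmetric groups\<close>

definition gen_sym_group :: "nat \<Rightarrow> nat \<Rightarrow> complex mat monoid" where
  "gen_sym_group k n =
    \<lparr>carrier = {A \<in> carrier_mat n n.
        (\<forall>i<n. \<exists>!j. j < n \<and> A $$ (i, j) \<noteq> 0) \<and>
        (\<forall>j<n. \<exists>!i. i < n \<and> A $$ (i, j) \<noteq> 0) \<and>
        (\<forall>i<n. \<forall>j<n. A $$ (i, j) \<noteq> 0 \<longrightarrow> A $$ (i, j) ^ k = 1)},
     monoid.mult = (*), one = 1\<^sub>m n\<rparr>"

definition p_regular :: "nat \<Rightarrow> 'a monoid \<Rightarrow> 'a set" where
  "p_regular p G = {g \<in> carrier G. coprime (group.ord G g) p}"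


subsection \<open>Symmetric powers\<close>

text \<open>
  The symmetric algebra on the basis \<open>e\<^sub>0, \<dots>, e\<^bsub>n-1\<^esub>\<close> of \<open>V\<close> is the polynomial ring in
  the \<open>e\<^sub>i\<close>, with \<open>(nat \<Rightarrow>\<^sub>0 nat) \<Rightarrow>\<^sub>0 'a\<close> as the type of polynomials over \<open>'a\<close> in countably
  many variables; \<open>Sym\<^sup>r V\<close> has the monomials of degree \<open>r\<close> in \<open>e\<^sub>0, \<dots>, e\<^bsub>n-1\<^esub>\<close> as a basis.
\<close>

definition monomials :: "nat \<Rightarrow> nat \<Rightarrow> (nat \<Rightarrow>\<^sub>0 nat) set" where
  "monomials n r = {\<alpha>. Poly_Mapping.keys \<alpha> \<subseteq> {..<n} \<and> (\<Sum>i<n. Poly_Mapping.lookup \<alpha> i) = r}"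

text \<open>The image of \<open>e\<^sub>v\<close> under \<open>A\<close>, as a polynomial of degree 1.\<close>

definition col_form :: "'a::comm_ring_1 mat \<Rightarrow> nat \<Rightarrow> (nat \<Rightarrow>\<^sub>0 nat) \<Rightarrow>\<^sub>0 'a" where
  "col_form A v =
    (\<Sum>u<dim_row A. Poly_Mapping.single (Poly_Mapping.single u 1) (A $$ (u, v)))"

text \<open>
  The matrix of \<open>Sym\<^sup>r A\<close> for a square matrix \<open>A\<close>: its \<open>j\<close>-th column holds the coefficients
  of the image \<open>\<Prod>\<^sub>v (A e\<^sub>v)\<^bsup>\<alpha> v\<^esup>\<close> of the \<open>j\<close>-th monomial \<open>\<alpha>\<close>. The ordering of the
  monomials is immaterial.
\<close>

definition sym_power_mat :: "nat \<Rightarrow> 'a::comm_ring_1 mat \<Rightarrow> 'a mat" where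
  "sym_power_mat r A =
    (let n = dim_row A; ms = sorted_list_of_set (monomials n r)
     in mat (length ms) (length ms)
          (\<lambda>(i, j). Poly_Mapping.lookup (\<Prod>v<n. col_form A v ^ Poly_Mapping.lookup (ms ! j) v) (ms ! i)))"

lemma finite_monomials: "finite (monomials n r)"
proof -
  have "Poly_Mapping.lookup ` monomials n r \<subseteq> {f. \<forall>i. (i \<in> {..<n} \<longrightarrow> f i \<in> {..r}) \<and> (i \<notin> {..<n} \<longrightarrow> f i = 0)}"
    by (auto simp: monomials_def in_keys_iff intro: member_le_sum)
  hence "finite (Poly_Mapping.lookup ` monomials n r)"
    by (rule finite_subset) (intro finite_set_of_finite_funs; simp)
  thus ?thesis
    by (rule finite_imageD) (auto intro!: inj_onI simp: lookup_inject)
qed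


subsection \<open>Brauer characters\<close>

definition brauer_lift :: "nat \<Rightarrow> (complex \<Rightarrow> 'f) \<Rightarrow> 'f \<Rightarrow> complex" where
  "brauer_lift p red x = (THE \<zeta>. (\<exists>m>0. coprime m p \<and> \<zeta> ^ m = 1) \<and> red \<zeta> = x)"

definition brauer_trace :: "nat \<Rightarrow> (complex \<Rightarrow> 'f::field) \<Rightarrow> 'f mat \<Rightarrow> complex" where
  "brauer_trace p red A = (\<Sum>x\<in>#proots (char_poly A). brauer_lift p red x)"

text \<open>
  Functions on the set of \<open>p\<close>-regular elements are represented by their extension by zero,
  so that linear relations between them are unaffected.
\<close>

definition sym_brauer_char ::
    "nat \<Rightarrow> (complex \<Rightarrow> 'f::field) \<Rightarrow> nat \<Rightarrow> nat \<Rightarrow> nat \<Rightarrow> complex mat \<Rightarrow> complex" where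
  "sym_brauer_char p red n k r g =
    (if g \<in> p_regular p (gen_sym_group k n)
     then brauer_trace p red (sym_power_mat r (map_mat red g)) else 0)"

definition B_dim :: "nat \<Rightarrow> (complex \<Rightarrow> 'f::field) \<Rightarrow> nat \<Rightarrow> nat \<Rightarrow> nat" where
  "B_dim p red n k =
    vector_space.dim (\<lambda>(c::complex) f x. c * f x) (range (sym_brauer_char p red n k))"

end

(*
  For a p-regular g in C_k wr S_n, the Brauer character of Sym^r V at g is the ordinary trace of
  Sym^r g, because the p-regular roots of unity reduce injectively. Summing over r gives the power
  series 1 / prod (1 - z t^l), the product running over the cycles of g, with l the length and z
  the product of the entries of a cycle; here l is prime to p and z^m = 1, where m = r_p(k). Since
  1 - z t^l divides 1 - t^(m r_p(j)) for every multiple j of l, each of these series has the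
  denominator D = prod_(j <= n) (1 - t^(m r_p(j))), with a numerator of degree at most deg D - n.
  Hence B(p,n,k) <= deg D - n + 1. Finally deg D is m times the sum of the r_p(j), j <= n, which
  is estimated by a recursion from n to n div p.
*)
theory Submission
  imports
    Defs
    "HOL-Computational_Algebra.Polynomial_FPS"
    "Jordan_Normal_Form.Schur_Decomposition"
begin

subsection \<open>The \<open>p'\<close>-part of an integer\<close>

text \<open>The difficulty is that one D must serve all p-regular g at once, including elements with
  several cycles of equal length, which need different factors of D. Each cycle of length l claims a
  block of l consecutive indices j. Such a block contains a multiple of l, and the lengths add up to
  n, so the blocks fill 1, ..., n. As l is prime to p, the exponent at j can be m r_p(j) instead of
  m j; this gives the saving over a leading term m n^2 / 2. The numerator is D divided by all 1 - z
  t^l, of total degree n, whence the term -n. D is independent of g, so expanding 1/D writes the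
  r-th character as a combination of the functions taking g to the i-th coefficient of its
  numerator, with scalars depending only on i and r. There are deg D - n + 1 such functions. The
  residue map respects sums and products on algebraic integers only, so characteristic polynomials
  are reduced relative to a subring.\<close>

lemma p'_part_not_dvd: "\<not> p dvd N \<Longrightarrow> p'_part p N = N"
  by (simp add: p'_part_def not_dvd_imp_multiplicity_0)

lemma p'_part_times_prime:
  assumes "prime p" "j > 0"
  shows "p'_part p (p * j) = p'_part p j"
proof -
  have "p > 0" using assms(1) by (simp add: prime_gt_0_nat)
  moreover have "multiplicity p (p * j) = Suc (multiplicity p j)"
    using assms not_prime_unit by (intro multiplicity_times_same) auto
  ultimately show ?thesis by (simp add: p'_part_def)
qed

lemma p'_part_times_power: "p'_part p k * p ^ multiplicity p k = k"
  by (simp add: p'_part_def multiplicity_dvd)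

lemma p'_part_pos: "k > 0 \<Longrightarrow> p'_part p k > 0"
  using p'_part_times_power[of p k] by (metis gr0I mult_0)

lemma coprime_dvd_p'_part:
  assumes "coprime l p" "l dvd k"
  shows "l dvd p'_part p k"
proof -
  have "l dvd p'_part p k * p ^ multiplicity p k"
    using assms(2) by (simp add: p'_part_times_power)
  moreover have "coprime l (p ^ multiplicity p k)" using assms(1) by simp
  ultimately show ?thesis by (simp add: coprime_dvd_mult_left_iff)
qed

text \<open>The power y of x is killed both by N and by the p-power contained in k; these exponents
  are coprime, so Bezout gives y = 1.\<close>

lemma power_p'_part_eq_1:
  fixes x :: "'a::field"
  assumes "x ^ k = 1" "x ^ N = 1" "coprime N p" "N > 0"
  shows "x ^ p'_part p k = 1"
proof -
  define y where "y = x ^ p'_part p k"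
  have y: "y ^ N = 1" "y ^ (p ^ multiplicity p k) = 1"
    using assms(1,2) by (simp_all add: y_def p'_part_times_power flip: power_mult)
      (simp add: power_mult mult.commute[of _ N])
  have "coprime N (p ^ multiplicity p k)" using assms(3) by simp
  then obtain u v where uv: "N * u = p ^ multiplicity p k * v + 1"
    using bezout_nat[of N "p ^ multiplicity p k"] assms(4) by auto
  have "y = y ^ (p ^ multiplicity p k * v) * y" using y(2) by (simp add: power_mult)
  also have "\<dots> = y ^ (N * u)" by (simp only: uv power_add power_one_right)
  also have "\<dots> = 1" using y(1) by (simp add: power_mult)
  finally show ?thesis by (simp add: y_def)
qed

section \<open>Sums of p'-parts\<close>

lemma sum_p'_part_rec:
  assumes "prime p"
  shows "(\<Sum>N=1..n. real (p'_part p N)) =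
    real n * (real n + 1) / 2 - real p * real (n div p) * (real (n div p) + 1) / 2
    + (\<Sum>N=1..n div p. real (p'_part p N))"
proof -
  have p: "p > 0" using assms by (simp add: prime_gt_0_nat)
  have img: "(*) p ` {1..n div p} = {N\<in>{1..n}. p dvd N}"
  proof (intro equalityI subsetI)
    fix N assume "N \<in> {N\<in>{1..n}. p dvd N}"
    then obtain j where "N = p * j" "1 \<le> p * j" "p * j \<le> n" by auto
    then show "N \<in> (*) p ` {1..n div p}"
      using p by (auto simp: less_eq_div_iff_mult_less_eq mult.commute intro!: imageI)
  qed (use p in \<open>auto simp: less_eq_div_iff_mult_less_eq mult.commute\<close>)
  have gauss: "(\<Sum>N=1..m. real N) = real m * (real m + 1) / 2" for m
    by (induction m) (auto simp: field_simps)
  \<comment> \<open>The difference lives on the multiples of p. There N = p j contributes the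
    p'-part of j in place of p j, so the same sum reappears with bound n div p.\<close>
  have "(\<Sum>N=1..n. real (p'_part p N) - real N) =
      (\<Sum>N\<in>{N\<in>{1..n}. p dvd N}. real (p'_part p N) - real N)"
    by (rule sum.mono_neutral_right) (auto simp: p'_part_not_dvd)
  also have "\<dots> = (\<Sum>j=1..n div p. real (p'_part p (p * j)) - real (p * j))"
    unfolding img[symmetric] by (subst sum.reindex) (use p in \<open>auto simp: inj_on_def\<close>)
  also have "\<dots> = (\<Sum>j=1..n div p. real (p'_part p j) - real p * real j)"
    by (rule sum.cong) (auto simp: p'_part_times_prime[OF assms])
  also have "\<dots> = (\<Sum>j=1..n div p. real (p'_part p j)) - real p * (\<Sum>j=1..n div p. real j)"
    by (simp add: sum_subtractf sum_distrib_left)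
  finally show ?thesis
    by (simp only: sum_subtractf gauss)
qed

text \<open>The leading coefficient C is the fixed point of the recursion: C = 1/2 - 1/(2p) + C/p^2
  gives C = p/(2p+2). Each level costs at most n in the linear term, and there are at most log_p n +
  1 levels.\<close>

lemma sum_p'_part_le:
  assumes "prime p" "n \<ge> 1"
  shows "(\<Sum>N=1..n. real (p'_part p N)) \<le>
    real p / (2 * real p + 2) * real n ^ 2 + real n * (log (real p) (real n) + 1)"
  using assms(2)
proof (induction n rule: less_induct)
  case (less n)
  define q s where "q = n div p" and "s = n mod p"
  define P where "P = real p"
  define L where "L = log P (real n)"
  have p: "p \<ge> 2" using assms(1) by (rule prime_ge_2_nat)
  then have P: "P \<ge> 2" by (simp add: P_def)
  have "n = p * q + s" by (simp add: q_def s_def)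
  then have n_eq: "real n = P * real q + real s" by (simp add: P_def)
  have "s < p" using p by (simp add: s_def)
  then have sP: "real s \<le> P" by (simp add: P_def)
  have L: "L \<ge> 0" using P less.prems by (simp add: L_def)
  \<comment> \<open>Passing to q = n div p lowers the logarithm by at least 1, which absorbs the + 1
    of the induction hypothesis.\<close>
  have Sq: "(\<Sum>N=1..q. real (p'_part p N)) \<le> P / (2 * P + 2) * real q ^ 2 + real q * L"
  proof (cases "q = 0")
    case False
    then have "q < n" "q \<ge> 1" using p less.prems by (auto simp: q_def)
    then have "(\<Sum>N=1..q. real (p'_part p N)) \<le>
        P / (2 * P + 2) * real q ^ 2 + real q * (log P (real q) + 1)"
      using less.IH by (simp add: P_def)
    moreover have "log P (real q) + 1 = log P (real q * P)"
      using False P by (subst log_mult) auto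
    moreover have "log P (real q * P) \<le> L"
      unfolding L_def using False P n_eq less.prems by (subst log_le_cancel_iff) (auto simp: mult.commute)
    ultimately show ?thesis
      by (smt (verit) mult_left_mono of_nat_0_le_iff)
  qed simp
  \<comment> \<open>Multiplied by 2P + 2, the inequality \<open>main\<close> below reads n^2 -
    (Pq)^2 <= (P+1)(n + Pq). Since n - Pq = s, this follows from s <= P + 1.\<close>
  have "real s * (real n + P * real q) \<le> (P + 1) * (real n + P * real q)"
    using sP P by (intro mult_right_mono) auto
  moreover have "real n ^ 2 - (P * real q) ^ 2 = real s * (real n + P * real q)"
    unfolding n_eq by (simp add: algebra_simps power2_eq_square)
  ultimately have "(P + 1) * (real n ^ 2 + real n) - P * (P + 1) * (real q ^ 2 + real q) + P * real q ^ 2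
      \<le> P * real n ^ 2 + 2 * (P + 1) * real n"
    by (simp add: algebra_simps power2_eq_square)
  then have "((P + 1) * (real n ^ 2 + real n) - P * (P + 1) * (real q ^ 2 + real q) + P * real q ^ 2) / (2 * P + 2)
      \<le> (P * real n ^ 2 + 2 * (P + 1) * real n) / (2 * P + 2)"
    using P by (intro divide_right_mono) auto
  then have main: "real n * (real n + 1) / 2 - P * real q * (real q + 1) / 2 + P / (2 * P + 2) * real q ^ 2
      \<le> P / (2 * P + 2) * real n ^ 2 + real n"
    using P by (simp add: field_simps power2_eq_square)
  have "q \<le> n" by (simp add: q_def)
  then have "real q * L \<le> real n * L" using L by (intro mult_right_mono) auto
  then show ?case
    using main Sq sum_p'_part_rec[OF assms(1), of n]
    unfolding P_def[symmetric] q_def[symmetric] L_def[symmetric] by (simp add: algebra_simps)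
qed

subsection \<open>Monomial matrices\<close>

text \<open>The linear map sending e_j to \<open>c j\<close> times the basis vector of index
  \<open>\<pi> j\<close>. With coefficients indexed by columns, powers multiply the values of c
  along the forward orbit of j.\<close>

definition monomial_mat :: "nat \<Rightarrow> (nat \<Rightarrow> nat) \<Rightarrow> (nat \<Rightarrow> 'a) \<Rightarrow> 'a::zero mat" where
  "monomial_mat n \<pi> c = mat n n (\<lambda>(i, j). if i = \<pi> j then c j else 0)"

lemma monomial_mat_carrier [simp]: "monomial_mat n \<pi> c \<in> carrier_mat n n"
  by (simp add: monomial_mat_def)

lemma dim_monomial_mat [simp]:
  "dim_row (monomial_mat n \<pi> c) = n" "dim_col (monomial_mat n \<pi> c) = n"
  by (simp_all add: monomial_mat_def)

lemma index_monomial_mat [simp]: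
  "i < n \<Longrightarrow> j < n \<Longrightarrow> monomial_mat n \<pi> c $$ (i, j) = (if i = \<pi> j then c j else 0)"
  by (simp add: monomial_mat_def)

lemma permutes_lessThan_less [simp]: "\<pi> permutes {..<n} \<Longrightarrow> \<pi> j < n \<longleftrightarrow> j < n" for n :: nat
  using permutes_in_image[of \<pi> "{..<n}" j] by simp

lemma monomial_mat_mult:
  fixes c c' :: "nat \<Rightarrow> 'a::semiring_0"
  assumes "\<pi>' permutes {..<n}"
  shows "monomial_mat n \<pi> c * monomial_mat n \<pi>' c' =
    monomial_mat n (\<pi> \<circ> \<pi>') (\<lambda>j. c (\<pi>' j) * c' j)"
proof (rule eq_matI)
  fix i j assume "i < dim_row (monomial_mat n (\<pi> \<circ> \<pi>') (\<lambda>j. c (\<pi>' j) * c' j))"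
    and "j < dim_col (monomial_mat n (\<pi> \<circ> \<pi>') (\<lambda>j. c (\<pi>' j) * c' j))"
  then have ij: "i < n" "j < n" by simp_all
  have "(monomial_mat n \<pi> c * monomial_mat n \<pi>' c') $$ (i, j) =
      (\<Sum>l<n. monomial_mat n \<pi> c $$ (i, l) * monomial_mat n \<pi>' c' $$ (l, j))"
    using ij by (simp add: scalar_prod_def atLeast0LessThan)
  also have "\<dots> = (\<Sum>l<n. if l = \<pi>' j then monomial_mat n \<pi> c $$ (i, l) * c' j else 0)"
    using ij by (intro sum.cong) auto
  also have "\<dots> = monomial_mat n \<pi> c $$ (i, \<pi>' j) * c' j"
    using ij assms by (subst sum.delta) auto
  finally show "(monomial_mat n \<pi> c * monomial_mat n \<pi>' c') $$ (i, j) =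
      monomial_mat n (\<pi> \<circ> \<pi>') (\<lambda>j. c (\<pi>' j) * c' j) $$ (i, j)"
    using ij assms by simp
qed simp_all

lemma monomial_mat_one: "monomial_mat n id (\<lambda>_. 1) = 1\<^sub>m n"
  by (rule eq_matI) auto

lemma monomial_mat_pow:
  fixes c :: "nat \<Rightarrow> 'a::comm_semiring_1"
  assumes "\<pi> permutes {..<n}"
  shows "monomial_mat n \<pi> c ^\<^sub>m N = monomial_mat n (\<pi> ^^ N) (\<lambda>j. \<Prod>i<N. c ((\<pi> ^^ i) j))"
proof (induction N)
  case 0
  show ?case by (simp add: monomial_mat_one[symmetric] id_def)
next
  case (Suc N)
  have "monomial_mat n \<pi> c ^\<^sub>m Suc N =
      monomial_mat n (\<pi> ^^ N \<circ> \<pi>) (\<lambda>j. (\<Prod>i<N. c ((\<pi> ^^ i) (\<pi> j))) * c j)"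
    by (simp add: Suc monomial_mat_mult[OF assms])
  also have "(\<lambda>j. (\<Prod>i<N. c ((\<pi> ^^ i) (\<pi> j))) * c j) = (\<lambda>j. \<Prod>i<Suc N. c ((\<pi> ^^ i) j))"
    by (subst prod.lessThan_Suc_shift) (simp add: funpow_swap1 mult.commute)
  also have "\<pi> ^^ N \<circ> \<pi> = \<pi> ^^ Suc N"
    by (simp add: funpow_Suc_right del: funpow.simps)
  finally show ?case .
qed

lemma monomial_mat_eq_oneD:
  fixes c :: "nat \<Rightarrow> 'a::zero_neq_one"
  assumes "monomial_mat n \<pi> c = 1\<^sub>m n" "j < n"
  shows "\<pi> j = j" "c j = 1"
proof -
  have "monomial_mat n \<pi> c $$ (j, j) = 1"
    using assms by simp
  then show "\<pi> j = j" "c j = 1"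
    using assms(2) by (auto split: if_splits)
qed

section \<open>Generalised symmetric groups as groups of monomial matrices\<close>

lemma carrier_gen_sym_group:
  assumes "k \<ge> 1"
  shows "carrier (gen_sym_group k n) =
    {monomial_mat n \<pi> c |\<pi> c. \<pi> permutes {..<n} \<and> (\<forall>j<n. c j ^ k = 1)}"
proof (intro equalityI subsetI)
  fix A assume "A \<in> carrier (gen_sym_group k n)"
  then have A: "A \<in> carrier_mat n n"
    and row: "\<And>i. i < n \<Longrightarrow> \<exists>!j. j < n \<and> A $$ (i, j) \<noteq> 0"
    and col: "\<And>j. j < n \<Longrightarrow> \<exists>!i. i < n \<and> A $$ (i, j) \<noteq> 0"
    and root: "\<And>i j. i < n \<Longrightarrow> j < n \<Longrightarrow> A $$ (i, j) \<noteq> 0 \<Longrightarrow> A $$ (i, j) ^ k = 1"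
    by (auto simp: gen_sym_group_def)
  \<comment> \<open>The identity outside {..<n}, as \<open>permutes\<close> demands.\<close>
  define \<pi> where "\<pi> j = (if j < n then THE i. i < n \<and> A $$ (i, j) \<noteq> 0 else j)" for j
  have \<pi>: "\<pi> j < n" "A $$ (\<pi> j, j) \<noteq> 0" if "j < n" for j
    using theI'[OF col[OF that]] that by (auto simp: \<pi>_def)
  have \<pi>_eq: "i = \<pi> j" if "i < n" "j < n" "A $$ (i, j) \<noteq> 0" for i j
    using col[of j] \<pi>[of j] that by blast
  have "inj_on \<pi> {..<n}"
  proof (rule inj_onI)
    fix j j' assume "j \<in> {..<n}" "j' \<in> {..<n}" "\<pi> j = \<pi> j'"
    then show "j = j'"
      using row[of "\<pi> j"] \<pi>[of j] \<pi>[of j'] by auto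
  qed
  moreover have "\<pi> ` {..<n} \<subseteq> {..<n}" using \<pi> by auto
  ultimately have "bij_betw \<pi> {..<n} {..<n}"
    by (simp add: bij_betw_def endo_inj_surj)
  then have "\<pi> permutes {..<n}"
    by (rule bij_imp_permutes) (simp add: \<pi>_def)
  moreover have "A = monomial_mat n \<pi> (\<lambda>j. A $$ (\<pi> j, j))"
    by (rule eq_matI) (use A \<pi>_eq in auto)
  moreover have "\<forall>j<n. A $$ (\<pi> j, j) ^ k = 1"
    using \<pi> root by blast
  ultimately show "A \<in> {monomial_mat n \<pi> c |\<pi> c. \<pi> permutes {..<n} \<and> (\<forall>j<n. c j ^ k = 1)}"
    by auto
next
  fix A :: "complex mat" assume "A \<in> {monomial_mat n \<pi> c |\<pi> c. \<pi> permutes {..<n} \<and> (\<forall>j<n. c j ^ k = 1)}"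
  then obtain \<pi> c where A: "A = monomial_mat n \<pi> c" and \<pi>: "\<pi> permutes {..<n}"
    and c: "\<And>j. j < n \<Longrightarrow> c j ^ k = 1" by blast
  have nz: "c j \<noteq> 0" if "j < n" for j
    using c[OF that] assms by (auto simp: power_0_left)
  have "\<exists>!j. j < n \<and> A $$ (i, j) \<noteq> 0" if "i < n" for i
  proof (rule ex1I[of _ "Hilbert_Choice.inv \<pi> i"])
    show "Hilbert_Choice.inv \<pi> i < n \<and> A $$ (i, Hilbert_Choice.inv \<pi> i) \<noteq> 0"
      using that \<pi> nz by (simp add: A permutes_inv permutes_inverses)
    show "j = Hilbert_Choice.inv \<pi> i" if "j < n \<and> A $$ (i, j) \<noteq> 0" for j
      using that \<open>i < n\<close> \<pi> by (auto simp: A permutes_inverses split: if_splits)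
  qed
  moreover have "\<exists>!i. i < n \<and> A $$ (i, j) \<noteq> 0" if "j < n" for j
    using that \<pi> nz by (intro ex1I[of _ "\<pi> j"]) (auto simp: A split: if_splits)
  ultimately show "A \<in> carrier (gen_sym_group k n)"
    using c by (auto simp: gen_sym_group_def A)
qed

text \<open>The order of an element is tied to its powers by group theory, so the group axioms are
  what turns p-regularity into an equation g^N = 1 with N prime to p.\<close>

lemma group_gen_sym_group:
  assumes "k \<ge> 1"
  shows "group (gen_sym_group k n)"
proof (rule groupI)
  have mult: "x \<otimes>\<^bsub>gen_sym_group k n\<^esub> y = x * y" and one: "\<one>\<^bsub>gen_sym_group k n\<^esub> = 1\<^sub>m n" for x y
    by (simp_all add: gen_sym_group_def)
  note carrier = carrier_gen_sym_group[OF assms]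
  show "\<one>\<^bsub>gen_sym_group k n\<^esub> \<in> carrier (gen_sym_group k n)"
    unfolding one carrier monomial_mat_one[symmetric] using permutes_id by fastforce
  fix x assume x: "x \<in> carrier (gen_sym_group k n)"
  then obtain \<pi> c where x_eq: "x = monomial_mat n \<pi> c" and \<pi>: "\<pi> permutes {..<n}"
    and c: "\<And>j. j < n \<Longrightarrow> c j ^ k = 1" unfolding carrier by blast
  show "\<one>\<^bsub>gen_sym_group k n\<^esub> \<otimes>\<^bsub>gen_sym_group k n\<^esub> x = x"
    by (simp add: mult one x_eq)
  have inv: "Hilbert_Choice.inv \<pi> permutes {..<n}" using \<pi> by (rule permutes_inv)
  have nz: "c j \<noteq> 0" if "j < n" for j
    using c[OF that] assms by (auto simp: power_0_left)
  show "\<exists>y\<in>carrier (gen_sym_group k n). y \<otimes>\<^bsub>gen_sym_group k n\<^esub> x = \<one>\<^bsub>gen_sym_group k n\<^esub>"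
  proof
    let ?y = "monomial_mat n (Hilbert_Choice.inv \<pi>) (\<lambda>j. inverse (c (Hilbert_Choice.inv \<pi> j)))"
    show "?y \<in> carrier (gen_sym_group k n)"
      using inv c by (auto simp: carrier power_inverse intro!: exI[of _ "Hilbert_Choice.inv \<pi>"])
    show "?y \<otimes>\<^bsub>gen_sym_group k n\<^esub> x = \<one>\<^bsub>gen_sym_group k n\<^esub>"
      unfolding mult one x_eq monomial_mat_mult[OF \<pi>]
      by (rule eq_matI) (use \<pi> nz in \<open>auto simp: permutes_inverses\<close>)
  qed
  fix y assume y: "y \<in> carrier (gen_sym_group k n)"
  then obtain \<pi>' c' where y_eq: "y = monomial_mat n \<pi>' c'" and \<pi>': "\<pi>' permutes {..<n}"
    and c': "\<And>j. j < n \<Longrightarrow> c' j ^ k = 1" unfolding carrier by blast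
  have "\<forall>j<n. (c (\<pi>' j) * c' j) ^ k = 1"
    using \<pi>' c c' by (simp add: power_mult_distrib)
  then show "x \<otimes>\<^bsub>gen_sym_group k n\<^esub> y \<in> carrier (gen_sym_group k n)"
    unfolding carrier mult x_eq y_eq monomial_mat_mult[OF \<pi>']
    using permutes_compose[OF \<pi>' \<pi>] by blast
  fix z assume "z \<in> carrier (gen_sym_group k n)"
  with x y show "x \<otimes>\<^bsub>gen_sym_group k n\<^esub> y \<otimes>\<^bsub>gen_sym_group k n\<^esub> z =
      x \<otimes>\<^bsub>gen_sym_group k n\<^esub> (y \<otimes>\<^bsub>gen_sym_group k n\<^esub> z)"
    unfolding mult by (intro assoc_mult_mat[of _ n n _ n _ n]) (auto simp: carrier)
qed

lemma p_regular_gen_sym_group_cases: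
  assumes "k \<ge> 1" "g \<in> p_regular p (gen_sym_group k n)"
  obtains \<pi> c N where "\<pi> permutes {..<n}" "\<And>j. j < n \<Longrightarrow> c j ^ k = 1"
    "g = monomial_mat n \<pi> c" "coprime N p" "g ^\<^sub>m N = 1\<^sub>m n"
proof -
  let ?G = "gen_sym_group k n"
  interpret group ?G using assms(1) by (rule group_gen_sym_group)
  have g: "g \<in> carrier ?G" "coprime (ord g) p"
    using assms(2) by (auto simp: p_regular_def)
  from g(1) obtain \<pi> c where *: "g = monomial_mat n \<pi> c" "\<pi> permutes {..<n}"
    "\<And>j. j < n \<Longrightarrow> c j ^ k = 1" unfolding carrier_gen_sym_group[OF assms(1)] by blast
  have "g [^]\<^bsub>?G\<^esub> N = g ^\<^sub>m N" for N :: nat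
  proof (induction N)
    case 0
    show ?case by (simp add: *(1)) (simp add: gen_sym_group_def)
  next
    case (Suc N)
    then show ?case by (simp add: gen_sym_group_def)
  qed
  then have "g ^\<^sub>m ord g = 1\<^sub>m n"
    using pow_ord_eq_1[OF g(1)] by (simp add: gen_sym_group_def)
  with * g(2) show thesis by (intro that)
qed

subsection \<open>Symmetric powers of monomial matrices\<close>

lemma col_form_monomial_mat:
  assumes "\<pi> permutes {..<n}" "v < n"
  shows "col_form (monomial_mat n \<pi> c) v =
    Poly_Mapping.single (Poly_Mapping.single (\<pi> v) 1) (c v)"
proof -
  have "col_form (monomial_mat n \<pi> c) v =
      (\<Sum>u<n. if u = \<pi> v then Poly_Mapping.single (Poly_Mapping.single u 1) (c v) else 0)"
    unfolding col_form_def using assms by (intro sum.cong) auto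
  also have "\<dots> = Poly_Mapping.single (Poly_Mapping.single (\<pi> v) 1) (c v)"
    using assms by (subst sum.delta) auto
  finally show ?thesis .
qed

lemma single_power:
  fixes a :: "'a::comm_monoid_add" and b :: "'b::comm_semiring_1"
  shows "Poly_Mapping.single a b ^ m = Poly_Mapping.single (\<Sum>i<m. a) (b ^ m)"
  by (induction m) (simp_all add: mult_single add.commute)

lemma sum_single_one: "(\<Sum>i<m. Poly_Mapping.single a (1::nat)) = Poly_Mapping.single a m"
  by (induction m) (simp_all flip: single_add)

lemma prod_single:
  fixes a :: "'i \<Rightarrow> 'a::comm_monoid_add" and b :: "'i \<Rightarrow> 'b::comm_semiring_1"
  shows "(\<Prod>i\<in>A. Poly_Mapping.single (a i) (b i)) = Poly_Mapping.single (\<Sum>i\<in>A. a i) (\<Prod>i\<in>A. b i)"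
  by (induction A rule: infinite_finite_induct) (simp_all add: mult_single)

lemma lookup_sum_single:
  fixes n :: nat
  assumes "\<pi> permutes {..<n}" "v < n"
  shows "Poly_Mapping.lookup (\<Sum>u<n. Poly_Mapping.single (\<pi> u) (a u)) (\<pi> v) = a v"
proof -
  have "Poly_Mapping.lookup (\<Sum>u<n. Poly_Mapping.single (\<pi> u) (a u)) (\<pi> v) =
      (\<Sum>u<n. if u = v then a v else 0)"
    unfolding lookup_sum using permutes_inj[OF assms(1)]
    by (intro sum.cong) (auto simp: lookup_single when_def dest: injD)
  also have "\<dots> = a v"
    using assms(2) by (subst sum.delta) auto
  finally show ?thesis .
qed

lemma lookup_map_key_permutes:
  "\<pi> permutes S \<Longrightarrow> Poly_Mapping.lookup (Poly_Mapping.map_key \<pi> \<alpha>) v = Poly_Mapping.lookup \<alpha> (\<pi> v)"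
  by (simp add: map_key.rep_eq permutes_inj)

lemma monomials_lookup_eq_0: "\<alpha> \<in> monomials n r \<Longrightarrow> v \<ge> n \<Longrightarrow> Poly_Mapping.lookup \<alpha> v = 0"
  by (auto simp: monomials_def in_keys_iff)

lemma map_key_in_monomials:
  assumes \<pi>: "\<pi> permutes {..<n}" and "\<alpha> \<in> monomials n r"
  shows "Poly_Mapping.map_key \<pi> \<alpha> \<in> monomials n r"
proof -
  have "(\<Sum>i<n. Poly_Mapping.lookup \<alpha> (\<pi> i)) = (\<Sum>i<n. Poly_Mapping.lookup \<alpha> i)"
    using sum.permute[OF \<pi>, of "Poly_Mapping.lookup \<alpha>"] by simp
  moreover have "v < n" if "Poly_Mapping.lookup \<alpha> (\<pi> v) \<noteq> 0" for v
    using that \<pi> monomials_lookup_eq_0[OF assms(2), of "\<pi> v"] by (meson not_le permutes_lessThan_less)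
  ultimately show ?thesis
    using assms by (auto simp: monomials_def in_keys_iff lookup_map_key_permutes[OF \<pi>])
qed

text \<open>The monomial with exponent \<alpha> goes to the one whose exponent is \<alpha> composed
  with the inverse of \<pi>. Composing the target \<beta> with \<pi> instead keeps the inverse out
  of all later formulas.\<close>

lemma sum_single_permuted_eq_iff:
  assumes \<pi>: "\<pi> permutes {..<n}" and \<alpha>: "\<alpha> \<in> monomials n r" and \<beta>: "\<beta> \<in> monomials n r"
  shows "(\<Sum>v<n. Poly_Mapping.single (\<pi> v) (Poly_Mapping.lookup \<alpha> v)) = \<beta> \<longleftrightarrow>
    Poly_Mapping.map_key \<pi> \<beta> = \<alpha>"
proof
  assume eq: "(\<Sum>v<n. Poly_Mapping.single (\<pi> v) (Poly_Mapping.lookup \<alpha> v)) = \<beta>"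
  show "Poly_Mapping.map_key \<pi> \<beta> = \<alpha>"
  proof (rule poly_mapping_eqI)
    fix v
    show "Poly_Mapping.lookup (Poly_Mapping.map_key \<pi> \<beta>) v = Poly_Mapping.lookup \<alpha> v"
    proof (cases "v < n")
      case True
      then show ?thesis
        by (simp add: lookup_map_key_permutes[OF \<pi>] eq[symmetric] lookup_sum_single[OF \<pi>])
    next
      case False
      then show ?thesis
        using monomials_lookup_eq_0[OF \<alpha>] monomials_lookup_eq_0[OF \<beta>]
        by (simp add: lookup_map_key_permutes[OF \<pi>] permutes_not_in[OF \<pi>])
    qed
  qed
next
  assume \<alpha>_eq: "Poly_Mapping.map_key \<pi> \<beta> = \<alpha>"
  show "(\<Sum>v<n. Poly_Mapping.single (\<pi> v) (Poly_Mapping.lookup \<alpha> v)) = \<beta>"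
  proof (rule poly_mapping_eqI)
    fix w
    obtain v where w: "w = \<pi> v" using permutes_surj[OF \<pi>] by blast
    show "Poly_Mapping.lookup (\<Sum>v<n. Poly_Mapping.single (\<pi> v) (Poly_Mapping.lookup \<alpha> v)) w =
        Poly_Mapping.lookup \<beta> w"
    proof (cases "v < n")
      case True
      then show ?thesis
        by (simp add: w lookup_sum_single[OF \<pi>] \<alpha>_eq[symmetric] lookup_map_key_permutes[OF \<pi>])
    next
      case False
      then have "\<pi> v = v" by (simp add: permutes_not_in[OF \<pi>])
      moreover from False have "Poly_Mapping.lookup (\<Sum>u<n. Poly_Mapping.single (\<pi> u) (Poly_Mapping.lookup \<alpha> u)) v = 0"
        unfolding lookup_sum using \<pi> by (intro sum.neutral ballI) (auto simp: lookup_single when_def)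
      ultimately show ?thesis
        using False monomials_lookup_eq_0[OF \<beta>] by (simp add: w)
    qed
  qed
qed

lemma dim_sym_power_mat [simp]:
  "dim_row (sym_power_mat r A) = card (monomials (dim_row A) r)"
  "dim_col (sym_power_mat r A) = card (monomials (dim_row A) r)"
  by (simp_all add: sym_power_mat_def Let_def)

lemma nth_monomials:
  "i < card (monomials n r) \<Longrightarrow> sorted_list_of_set (monomials n r) ! i \<in> monomials n r"
  using nth_mem[of i "sorted_list_of_set (monomials n r)"] by (simp add: finite_monomials)

text \<open>A monomial matrix takes each monomial to a scalar multiple of another one, so its
  symmetric powers are monomial as well.\<close>

lemma index_sym_power_monomial_mat:
  fixes c :: "nat \<Rightarrow> 'a::comm_ring_1"
  assumes \<pi>: "\<pi> permutes {..<n}"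
    and "i < card (monomials n r)" "j < card (monomials n r)"
  defines "ms \<equiv> sorted_list_of_set (monomials n r)"
  shows "sym_power_mat r (monomial_mat n \<pi> c) $$ (i, j) =
    (if Poly_Mapping.map_key \<pi> (ms ! i) = ms ! j
     then \<Prod>v<n. c v ^ Poly_Mapping.lookup (ms ! j) v else 0)"
proof -
  let ?\<alpha> = "ms ! j" and ?\<beta> = "ms ! i"
  have mem: "?\<alpha> \<in> monomials n r" "?\<beta> \<in> monomials n r"
    using assms nth_monomials by auto
  have "(\<Prod>v<n. col_form (monomial_mat n \<pi> c) v ^ Poly_Mapping.lookup ?\<alpha> v) =
      (\<Prod>v<n. Poly_Mapping.single (Poly_Mapping.single (\<pi> v) (Poly_Mapping.lookup ?\<alpha> v))
        (c v ^ Poly_Mapping.lookup ?\<alpha> v))"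
    using \<pi> by (intro prod.cong)
      (simp_all only: lessThan_iff col_form_monomial_mat single_power sum_single_one)
  also have "\<dots> = Poly_Mapping.single (\<Sum>v<n. Poly_Mapping.single (\<pi> v) (Poly_Mapping.lookup ?\<alpha> v))
      (\<Prod>v<n. c v ^ Poly_Mapping.lookup ?\<alpha> v)"
    by (rule prod_single)
  finally show ?thesis
    using assms sum_single_permuted_eq_iff[OF \<pi> mem]
    by (simp add: sym_power_mat_def Let_def lookup_single when_def)
qed

text \<open>Needed so that Sym^r g inherits the equation g^N = 1.\<close>

lemma sym_power_monomial_mat_mult:
  fixes c c' :: "nat \<Rightarrow> 'a::comm_ring_1"
  assumes \<pi>: "\<pi> permutes {..<n}" and \<pi>': "\<pi>' permutes {..<n}"
  shows "sym_power_mat r (monomial_mat n \<pi> c * monomial_mat n \<pi>' c') =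
    sym_power_mat r (monomial_mat n \<pi> c) * sym_power_mat r (monomial_mat n \<pi>' c')"
    (is "?L = ?A * ?B")
proof (rule eq_matI)
  fix i j assume "i < dim_row (?A * ?B)" "j < dim_col (?A * ?B)"
  then have ij: "i < card (monomials n r)" "j < card (monomials n r)" by simp_all
  let ?ms = "sorted_list_of_set (monomials n r)"
  define d where "d \<alpha> = (\<Prod>v<n. c v ^ Poly_Mapping.lookup \<alpha> v)" for \<alpha>
  define d' where "d' \<alpha> = (\<Prod>v<n. c' v ^ Poly_Mapping.lookup \<alpha> v)" for \<alpha>
  have "Poly_Mapping.map_key \<pi> (?ms ! i) \<in> set ?ms"
    using map_key_in_monomials[OF \<pi> nth_monomials[OF ij(1)]] by (simp add: finite_monomials)
  \<comment> \<open>Row i of the left factor can be non-zero only in column l, so the matrix product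
    collapses to one term.\<close>
  then obtain l where l: "l < card (monomials n r)" "?ms ! l = Poly_Mapping.map_key \<pi> (?ms ! i)"
    by (auto simp: in_set_conv_nth)
  have "(?A * ?B) $$ (i, j) = (\<Sum>u<card (monomials n r). ?A $$ (i, u) * ?B $$ (u, j))"
    using ij by (simp add: scalar_prod_def atLeast0LessThan)
  also have "\<dots> = (\<Sum>u<card (monomials n r). if u = l then d (?ms ! l) * ?B $$ (l, j) else 0)"
  proof (rule sum.cong, simp)
    fix u assume "u \<in> {..<card (monomials n r)}"
    then show "?A $$ (i, u) * ?B $$ (u, j) = (if u = l then d (?ms ! l) * ?B $$ (l, j) else 0)"
      using ij l nth_eq_iff_index_eq[of ?ms l u]
      by (auto simp: index_sym_power_monomial_mat[OF \<pi>] d_def simp del: l(2) simp flip: l(2))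
  qed
  also have "\<dots> = d (?ms ! l) * ?B $$ (l, j)"
    using l by simp
  also have "\<dots> = ?L $$ (i, j)"
  proof -
    have "Poly_Mapping.map_key \<pi>' (?ms ! l) = Poly_Mapping.map_key (\<pi> \<circ> \<pi>') (?ms ! i)"
      unfolding l(2) using \<pi> \<pi>' by (intro map_key_compose permutes_inj)
    moreover have "d (?ms ! l) * d' (?ms ! j) =
        (\<Prod>v<n. (c (\<pi>' v) * c' v) ^ Poly_Mapping.lookup (?ms ! j) v)"
      if "Poly_Mapping.map_key \<pi>' (?ms ! l) = ?ms ! j"
    proof -
      have "d (?ms ! l) = (\<Prod>v<n. c (\<pi>' v) ^ Poly_Mapping.lookup (?ms ! l) (\<pi>' v))"
        unfolding d_def using prod.permute[OF \<pi>', of "\<lambda>v. c v ^ Poly_Mapping.lookup (?ms ! l) v"]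
        by simp
      also have "\<dots> = (\<Prod>v<n. c (\<pi>' v) ^ Poly_Mapping.lookup (?ms ! j) v)"
        by (simp add: that[symmetric] lookup_map_key_permutes[OF \<pi>'])
      finally show ?thesis
        by (simp add: d'_def power_mult_distrib prod.distrib)
    qed
    ultimately show ?thesis
      using ij l(1) permutes_compose[OF \<pi>' \<pi>]
      by (simp add: monomial_mat_mult[OF \<pi>'] index_sym_power_monomial_mat \<pi>' d'_def)
  qed
  finally show "?L $$ (i, j) = (?A * ?B) $$ (i, j)" by simp
qed simp_all

lemma sym_power_mat_one: "sym_power_mat r (1\<^sub>m n :: 'a::comm_ring_1 mat) = 1\<^sub>m (card (monomials n r))"
proof (rule eq_matI)
  fix i j assume "i < dim_row (1\<^sub>m (card (monomials n r)) :: 'a mat)"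
    "j < dim_col (1\<^sub>m (card (monomials n r)) :: 'a mat)"
  then have ij: "i < card (monomials n r)" "j < card (monomials n r)" by simp_all
  have "Poly_Mapping.map_key id \<alpha> = \<alpha>" for \<alpha> :: "nat \<Rightarrow>\<^sub>0 nat"
    using map_key_id[of \<alpha>] by (simp add: id_def)
  then show "sym_power_mat r (1\<^sub>m n :: 'a mat) $$ (i, j) = 1\<^sub>m (card (monomials n r)) $$ (i, j)"
    using ij nth_eq_iff_index_eq[of "sorted_list_of_set (monomials n r)" i j]
    by (simp add: index_sym_power_monomial_mat permutes_id flip: monomial_mat_one)
qed simp_all

lemma sym_power_monomial_mat_pow:
  fixes c :: "nat \<Rightarrow> 'a::comm_ring_1"
  assumes "\<pi> permutes {..<n}"
  shows "sym_power_mat r (monomial_mat n \<pi> c ^\<^sub>m N) = sym_power_mat r (monomial_mat n \<pi> c) ^\<^sub>m N"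
proof (induction N)
  case 0
  show ?case by (simp add: sym_power_mat_one)
next
  case (Suc N)
  have "\<pi> ^^ N permutes {..<n}" using assms by (induction N) (auto simp: permutes_id permutes_compose)
  then show ?case
    using Suc by (simp add: monomial_mat_pow[OF assms] sym_power_monomial_mat_mult assms)
qed

text \<open>Multiplicativity of f is demanded just for monomials in the coefficients c, which suits
  a residue map that respects products of algebraic integers only.\<close>

lemma map_mat_sym_power_monomial_mat:
  fixes c :: "nat \<Rightarrow> 'a::comm_ring_1" and f :: "'a \<Rightarrow> 'b::comm_ring_1"
  assumes \<pi>: "\<pi> permutes {..<n}" and "f 0 = 0"
    and "\<And>\<alpha>. f (\<Prod>v<n. c v ^ \<alpha> v) = (\<Prod>v<n. f (c v) ^ \<alpha> v)"
  shows "sym_power_mat r (map_mat f (monomial_mat n \<pi> c)) =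
    map_mat f (sym_power_mat r (monomial_mat n \<pi> c))"
proof -
  have "map_mat f (monomial_mat n \<pi> c) = monomial_mat n \<pi> (f \<circ> c)"
    by (rule eq_matI) (use assms(2) in auto)
  then show ?thesis
    using assms(2,3) by (intro eq_matI) (auto simp: index_sym_power_monomial_mat[OF \<pi>])
qed

subsection \<open>Homomorphisms on subrings\<close>

text \<open>The residue map is a total function on the complex numbers, but meaningful on algebraic
  integers only. Hence f lives on the whole type, while the laws are required on R.\<close>

locale subring_hom =
  fixes R :: "'a::comm_ring_1 set" and f :: "'a \<Rightarrow> 'b::comm_ring_1"
  assumes zero_closed: "0 \<in> R"
    and one_closed: "1 \<in> R"
    and add_closed: "x \<in> R \<Longrightarrow> y \<in> R \<Longrightarrow> x + y \<in> R"
    and uminus_closed: "x \<in> R \<Longrightarrow> - x \<in> R"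
    and mult_closed: "x \<in> R \<Longrightarrow> y \<in> R \<Longrightarrow> x * y \<in> R"
    and hom_one: "f 1 = 1"
    and hom_add: "x \<in> R \<Longrightarrow> y \<in> R \<Longrightarrow> f (x + y) = f x + f y"
    and hom_mult: "x \<in> R \<Longrightarrow> y \<in> R \<Longrightarrow> f (x * y) = f x * f y"
begin

lemma hom_zero: "f 0 = 0"
  using hom_add[OF zero_closed zero_closed] by simp

lemma hom_uminus: "x \<in> R \<Longrightarrow> f (- x) = - f x"
  using hom_add[of x "- x"] uminus_closed[of x] hom_zero by (simp add: add_eq_0_iff)

lemma sum_closed: "(\<And>x. x \<in> A \<Longrightarrow> g x \<in> R) \<Longrightarrow> sum g A \<in> R"
  by (induction A rule: infinite_finite_induct) (auto simp: zero_closed add_closed)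

lemma prod_closed: "(\<And>x. x \<in> A \<Longrightarrow> g x \<in> R) \<Longrightarrow> prod g A \<in> R"
  by (induction A rule: infinite_finite_induct) (auto simp: one_closed mult_closed)

lemma power_closed: "x \<in> R \<Longrightarrow> x ^ m \<in> R"
  by (induction m) (auto simp: one_closed mult_closed)

lemma hom_sum: "(\<And>x. x \<in> A \<Longrightarrow> g x \<in> R) \<Longrightarrow> f (sum g A) = (\<Sum>x\<in>A. f (g x))"
  by (induction A rule: infinite_finite_induct) (auto simp: hom_zero hom_add sum_closed)

lemma hom_prod: "(\<And>x. x \<in> A \<Longrightarrow> g x \<in> R) \<Longrightarrow> f (prod g A) = (\<Prod>x\<in>A. f (g x))"
  by (induction A rule: infinite_finite_induct) (auto simp: hom_one hom_mult prod_closed)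

lemma hom_power: "x \<in> R \<Longrightarrow> f (x ^ m) = f x ^ m"
  by (induction m) (auto simp: hom_one hom_mult power_closed)

text \<open>Makes \<open>hom_det\<close> applicable to the characteristic matrix, whose entries are
  polynomials over R.\<close>

lemma poly_subring_hom: "subring_hom {p. \<forall>i. coeff p i \<in> R} (map_poly f)"
proof
  fix p q :: "'a poly" assume pq: "p \<in> {p. \<forall>i. coeff p i \<in> R}" "q \<in> {p. \<forall>i. coeff p i \<in> R}"
  then show "p * q \<in> {p. \<forall>i. coeff p i \<in> R}"
    by (auto simp: coeff_mult intro!: sum_closed mult_closed)
  show "map_poly f (p * q) = map_poly f p * map_poly f q"
    using pq by (intro poly_eqI)
      (simp add: coeff_map_poly hom_zero coeff_mult hom_sum hom_mult mult_closed)
qed (auto intro!: poly_eqI simp: coeff_map_poly hom_zero hom_one hom_add one_closed zero_closed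
    add_closed uminus_closed simp flip: monom_0)

lemma hom_det:
  assumes "A \<in> carrier_mat n n" "\<And>i j. i < n \<Longrightarrow> j < n \<Longrightarrow> A $$ (i, j) \<in> R"
  shows "f (det A) = det (map_mat f A)"
proof -
  have sign: "signof \<sigma> \<in> R" "f (signof \<sigma>) = signof \<sigma>" for \<sigma> :: "nat \<Rightarrow> nat"
    using one_closed uminus_closed hom_uminus hom_one by (auto simp: sign_def)
  have entry: "i \<in> {0..<n} \<Longrightarrow> A $$ (i, \<sigma> i) \<in> R" if "\<sigma> permutes {0..<n}" for \<sigma> i
    using assms(2)[of i "\<sigma> i"] permutes_in_image[OF that, of i] by simp
  have "f (det A) = (\<Sum>\<sigma> | \<sigma> permutes {0..<n}. f (signof \<sigma> * (\<Prod>i=0..<n. A $$ (i, \<sigma> i))))"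
    unfolding det_def'[OF assms(1)]
    by (rule hom_sum) (use sign entry in \<open>auto intro!: mult_closed prod_closed\<close>)
  also have "\<dots> = (\<Sum>\<sigma> | \<sigma> permutes {0..<n}. signof \<sigma> * (\<Prod>i=0..<n. map_mat f A $$ (i, \<sigma> i)))"
  proof (rule sum.cong, simp)
    fix \<sigma> assume "\<sigma> \<in> {\<sigma>. \<sigma> permutes {0..<n}}"
    then have \<sigma>: "\<sigma> permutes {0..<n}" by simp
    have "f (\<Prod>i=0..<n. A $$ (i, \<sigma> i)) = (\<Prod>i=0..<n. f (A $$ (i, \<sigma> i)))"
      by (rule hom_prod) (rule entry[OF \<sigma>])
    also have "\<dots> = (\<Prod>i=0..<n. map_mat f A $$ (i, \<sigma> i))"
    proof (rule prod.cong, simp)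
      fix i assume "i \<in> {0..<n}"
      then show "f (A $$ (i, \<sigma> i)) = map_mat f A $$ (i, \<sigma> i)"
        using assms(1) permutes_in_image[OF \<sigma>, of i] by simp
    qed
    finally show "f (signof \<sigma> * (\<Prod>i=0..<n. A $$ (i, \<sigma> i))) =
        signof \<sigma> * (\<Prod>i=0..<n. map_mat f A $$ (i, \<sigma> i))"
      using sign entry[OF \<sigma>] by (subst hom_mult) (auto intro!: prod_closed)
  qed
  also have "\<dots> = det (map_mat f A)"
    by (rule det_def'[symmetric]) (use assms(1) in simp)
  finally show ?thesis .
qed

lemma hom_char_poly:
  assumes A: "A \<in> carrier_mat n n" and R: "\<And>i j. i < n \<Longrightarrow> j < n \<Longrightarrow> A $$ (i, j) \<in> R"
  shows "char_poly (map_mat f A) = map_poly f (char_poly A)"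
proof -
  interpret poly: subring_hom "{p. \<forall>i. coeff p i \<in> R}" "map_poly f"
    by (rule poly_subring_hom)
  have "map_poly f (char_poly A) = det (map_mat (map_poly f) (char_poly_matrix A))"
    unfolding char_poly_def
  proof (rule poly.hom_det)
    show "char_poly_matrix A \<in> carrier_mat n n" using A by simp
    show "char_poly_matrix A $$ (i, j) \<in> {p. \<forall>i. coeff p i \<in> R}" if "i < n" "j < n" for i j
      using that A R by (auto simp: char_poly_matrix_def coeff_pCons zero_closed one_closed
        uminus_closed add_closed split: nat.splits intro!: add_closed)
  qed
  also have "map_mat (map_poly f) (char_poly_matrix A) = char_poly_matrix (map_mat f A)"
    by (rule eq_matI) (use A R in \<open>auto simp: char_poly_matrix_def coeff_map_poly hom_zero hom_one
      hom_uminus hom_add uminus_closed zero_closed coeff_pCons split: nat.splits intro!: poly_eqI\<close>)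
  finally show ?thesis by (simp add: char_poly_def)
qed

end

subsection \<open>Brauer traces of matrices of finite order\<close>

lemma algebraic_int_root_of_unity:
  fixes x :: "'a::field_char_0"
  assumes "m > 0" "x ^ m = 1"
  shows "algebraic_int x"
  by (rule algebraic_int_root[of 1 "monom 1 m"])
    (use assms in \<open>auto simp: poly_monom degree_monom_eq\<close>)

lemma
  assumes M: "maximalideal M alg_ints"
    and \<phi>: "\<phi> \<in> ring_iso (alg_ints Quot M) (class_ring :: 'f::field ring)"
  shows subring_hom_reduction: "subring_hom {x. algebraic_int x} (reduction M \<phi>)"
    and reduction_eq_0: "x \<in> M \<Longrightarrow> reduction M \<phi> x = 0"
proof -
  interpret maximalideal M alg_ints by (rule M)
  have ops: "carrier alg_ints = {x. algebraic_int x}" "x \<otimes>\<^bsub>alg_ints\<^esub> y = x * y"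
    "x \<oplus>\<^bsub>alg_ints\<^esub> y = x + y" "\<one>\<^bsub>alg_ints\<^esub> = 1" "\<zero>\<^bsub>alg_ints\<^esub> = 0" for x y :: complex
    by (simp_all add: alg_ints_def)
  have hom: "reduction M \<phi> \<in> Ring.ring_hom alg_ints (class_ring :: 'f ring)"
  proof -
    have "\<phi> \<in> Ring.ring_hom (alg_ints Quot M) (class_ring :: 'f ring)"
      using \<phi> by (simp add: ring_iso_def)
    then have "\<phi> \<circ> (+>\<^bsub>alg_ints\<^esub>) M \<in> Ring.ring_hom alg_ints (class_ring :: 'f ring)"
      by (rule ring_hom_trans[OF rcos_ring_hom])
    then show ?thesis by (simp add: reduction_def[abs_def] comp_def)
  qed
  show sub: "subring_hom {x. algebraic_int x} (reduction M \<phi>)"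
  proof
    fix x y :: complex assume xy: "x \<in> {x. algebraic_int x}" "y \<in> {x. algebraic_int x}"
    \<comment> \<open>Closure of the algebraic integers under sums and products is read off from the
      ring axioms for \<open>alg_ints\<close> contained in \<open>maximalideal\<close>.\<close>
    show "x + y \<in> {x. algebraic_int x}"
      using a_closed[of x y] xy by (simp add: ops)
    show "x * y \<in> {x. algebraic_int x}"
      using m_closed[of x y] xy by (simp add: ops)
    show "reduction M \<phi> (x + y) = reduction M \<phi> x + reduction M \<phi> y"
      using ring_hom_add[OF hom, of x y] xy by (simp add: ops)
    show "reduction M \<phi> (x * y) = reduction M \<phi> x * reduction M \<phi> y"
      using ring_hom_mult[OF hom, of x y] xy by (simp add: ops)
  qed (use ring_hom_one[OF hom] in \<open>simp_all add: ops\<close>)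
  assume "x \<in> M"
  then have "M +>\<^bsub>alg_ints\<^esub> x = M +>\<^bsub>alg_ints\<^esub> 0"
    using a_rcos_const[of x] a_rcos_const[OF additive_subgroup.zero_closed[OF is_additive_subgroup]]
    by (simp add: ops)
  then show "reduction M \<phi> x = 0"
    using subring_hom.hom_zero[OF sub] by (simp add: reduction_def)
qed

text \<open>If x and y differed, dividing x^m - y^m = 0 by x - y would give a vanishing sum of the
  terms y^(m-1-i) x^i. Under f, where x and y agree, it becomes m f(y)^(m-1), which is non-zero
  because f(y) is a root of unity and m is non-zero in the field.\<close>

lemma hom_root_of_unity_inj:
  fixes f :: "'a::idom \<Rightarrow> 'b::field"
  assumes "subring_hom R f" and R: "x \<in> R" "y \<in> R"
    and roots: "x ^ m = 1" "y ^ m = 1" and m: "of_nat m \<noteq> (0 :: 'b)" and eq: "f x = f y"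
  shows "x = y"
proof (rule ccontr)
  interpret subring_hom R f by fact
  assume "x \<noteq> y"
  have "(x - y) * (\<Sum>i<m. y ^ (m - Suc i) * x ^ i) = 0"
    unfolding power_diff_sumr2[symmetric] using roots by simp
  with \<open>x \<noteq> y\<close> have "(\<Sum>i<m. y ^ (m - Suc i) * x ^ i) = 0" by simp
  then have "0 = f (\<Sum>i<m. y ^ (m - Suc i) * x ^ i)"
    using hom_zero by simp
  also have "\<dots> = (\<Sum>i<m. f y ^ (m - Suc i) * f y ^ i)"
    using R by (subst hom_sum) (simp_all add: hom_mult hom_power mult_closed power_closed eq)
  also have "\<dots> = (\<Sum>i<m. f y ^ (m - 1))"
    by (intro sum.cong refl) (simp only: power_add[symmetric] lessThan_iff, simp)
  finally have "f y ^ (m - 1) = 0" using m by simp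
  moreover have "f y ^ m = 1"
    using hom_power[OF R(2), of m] roots hom_one by simp
  ultimately show False
    by (cases m) (use m in auto)
qed

lemma of_nat_coprime_neq_0:
  assumes "of_nat p = (0 :: 'a::comm_ring_1)" "coprime m p"
  shows "of_nat m \<noteq> (0 :: 'a)"
proof
  assume m: "of_nat m = (0 :: 'a)"
  have "gcd (int m) (int p) = 1" using assms(2) by simp
  then obtain u v where "u * int m + v * int p = 1"
    using bezout_int[of "int m" "int p"] by metis
  then have "of_int (u * int m + v * int p) = (1 :: 'a)" by simp
  then show False using m assms(1) by simp
qed

lemma brauer_lift_hom:
  fixes f :: "complex \<Rightarrow> 'f::field"
  assumes f: "subring_hom {x. algebraic_int x} f" "of_nat p = (0 :: 'f)"
    and m: "m > 0" "coprime m p" and \<zeta>: "\<zeta> ^ m = 1"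
  shows "brauer_lift p f (f \<zeta>) = \<zeta>"
  unfolding brauer_lift_def
proof (rule the_equality)
  show "(\<exists>m>0. coprime m p \<and> \<zeta> ^ m = 1) \<and> f \<zeta> = f \<zeta>"
    using m \<zeta> by blast
next
  fix \<xi> assume "(\<exists>m>0. coprime m p \<and> \<xi> ^ m = 1) \<and> f \<xi> = f \<zeta>"
  then obtain l where l: "l > 0" "coprime l p" "\<xi> ^ l = 1" and eq: "f \<xi> = f \<zeta>" by blast
  show "\<xi> = \<zeta>"
  \<comment> \<open>The two roots may come with different exponents; l * m serves both and is still
    prime to p.\<close>
  proof (rule hom_root_of_unity_inj[OF f(1), of _ _ "l * m"])
    show "\<xi> ^ (l * m) = 1" using l by (simp add: power_mult)
    show "\<zeta> ^ (l * m) = 1" using \<zeta> by (simp add: power_mult mult.commute[of l])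
    show "of_nat (l * m) \<noteq> (0 :: 'f)"
      using f(2) l m by (intro of_nat_coprime_neq_0[of p]) auto
    show "\<xi> \<in> {x. algebraic_int x}" "\<zeta> \<in> {x. algebraic_int x}"
      using algebraic_int_root_of_unity[OF l(1,3)] algebraic_int_root_of_unity[OF m(1) \<zeta>] by simp_all
  qed (fact eq)
qed

lemma (in subring_hom) map_poly_prod_list_linear:
  assumes "set as \<subseteq> R"
  shows "map_poly f (\<Prod>a\<leftarrow>as. [:- a, 1:]) = (\<Prod>a\<leftarrow>as. [:- f a, 1:])"
proof -
  interpret poly: subring_hom "{p. \<forall>i. coeff p i \<in> R}" "map_poly f"
    by (rule poly_subring_hom)
  have linear: "[:- a, 1:] \<in> {p. \<forall>i. coeff p i \<in> R}"
    "map_poly f [:- a, 1:] = [:- f a, 1:]" if "a \<in> R" for a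
    using that by (auto simp: coeff_pCons zero_closed one_closed uminus_closed coeff_map_poly
      hom_zero hom_one hom_uminus intro!: poly_eqI split: nat.splits)
  \<comment> \<open>Membership in the subring is carried along because multiplicativity of
    \<open>map_poly f\<close> asks for it in the induction step.\<close>
  have "map_poly f (\<Prod>a\<leftarrow>as. [:- a, 1:]) = (\<Prod>a\<leftarrow>as. [:- f a, 1:]) \<and>
      (\<Prod>a\<leftarrow>as. [:- a, 1:]) \<in> {p. \<forall>i. coeff p i \<in> R}"
    using assms
  proof (induction as)
    case Nil
    then show ?case using poly.hom_one poly.one_closed by simp
  next
    case (Cons a as)
    then show ?case
      using linear[of a] poly.hom_mult poly.mult_closed by (simp del: mem_Collect_eq mult_pCons_left)
  qed
  then show ?thesis ..
qed

lemma proots_prod_list_linear: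
  "proots (\<Prod>a\<leftarrow>as. [:- a, 1:]) = mset (as :: 'a::idom list)"
proof (induction as)
  case (Cons a as)
  moreover have "(\<Prod>a\<leftarrow>as. [:- a, 1:]) \<noteq> 0"
    by (auto simp: prod_list_zero_iff)
  ultimately show ?case
    by (simp add: proots_mult del: mult_pCons_left)
qed simp

lemma sum_diag_mult_commute:
  fixes A B :: "'a::comm_semiring_0 mat"
  assumes "A \<in> carrier_mat n n" "B \<in> carrier_mat n n"
  shows "(\<Sum>i<n. (A * B) $$ (i, i)) = (\<Sum>i<n. (B * A) $$ (i, i))"
proof -
  have "(\<Sum>i<n. (A * B) $$ (i, i)) = (\<Sum>i<n. \<Sum>j<n. A $$ (i, j) * B $$ (j, i))"
    using assms by (intro sum.cong) (auto simp: scalar_prod_def atLeast0LessThan)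
  also have "\<dots> = (\<Sum>j<n. \<Sum>i<n. B $$ (j, i) * A $$ (i, j))"
    by (subst sum.swap) (simp add: mult.commute)
  also have "\<dots> = (\<Sum>i<n. (B * A) $$ (i, i))"
    using assms by (intro sum.cong) (auto simp: scalar_prod_def atLeast0LessThan)
  finally show ?thesis .
qed

text \<open>Schur decomposition makes A similar to a triangular matrix with these roots on its
  diagonal, and similar matrices have equal traces.\<close>

lemma sum_diag_eq_sum_list_roots:
  fixes A :: "'a::conjugatable_ordered_field mat"
  assumes A: "A \<in> carrier_mat n n" and as: "char_poly A = (\<Prod>a\<leftarrow>as. [:- a, 1:])"
  shows "(\<Sum>i<n. A $$ (i, i)) = sum_list as"
proof -
  obtain B P Q where B: "schur_decomposition A as = (B, P, Q)"
    by (metis prod_cases3)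
  have sim: "similar_mat_wit A B P Q" and diag: "diag_mat B = as"
    using schur_decomposition[OF A as B] by auto
  note wit = similar_mat_witD2[OF A sim]
  have "(\<Sum>i<n. A $$ (i, i)) = (\<Sum>i<n. (P * (B * Q)) $$ (i, i))"
    using wit assoc_mult_mat[of P n n B n Q n] by simp
  also have "\<dots> = (\<Sum>i<n. (B * Q * P) $$ (i, i))"
    using wit by (intro sum_diag_mult_commute) auto
  also have "B * Q * P = B"
    using wit assoc_mult_mat[of B n n Q n P n] by simp
  also have "(\<Sum>i<n. B $$ (i, i)) = sum_list as"
    using wit by (simp add: diag[symmetric] diag_mat_def sum_list_sum_nth atLeast0LessThan)
  finally show ?thesis .
qed

lemma eigenvalue_finite_order:
  fixes A :: "'a::field mat"
  assumes A: "A \<in> carrier_mat n n" and pow: "A ^\<^sub>m N = 1\<^sub>m n" and "eigenvalue A a"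
  shows "a ^ N = 1"
proof -
  obtain v where v: "eigenvector A v a" using assms(3) by (auto simp: eigenvalue_def)
  then have carrier: "v \<in> carrier_vec n" and nz: "v \<noteq> 0\<^sub>v n"
    using A by (auto simp: eigenvector_def)
  have "a ^ N \<cdot>\<^sub>v v = v"
    using eigenvector_pow[OF A v, of N] pow carrier by simp
  moreover obtain i where "i < n" "v $ i \<noteq> 0"
    using carrier nz by (metis carrier_vecD eq_vecI index_zero_vec)
  ultimately have "a ^ N * v $ i = v $ i"
    using carrier by (metis carrier_vecD index_smult_vec(1))
  then show ?thesis using \<open>v $ i \<noteq> 0\<close> by simp
qed

text \<open>The eigenvalues of A are N-th roots of unity, and f carries the factorisation of its
  characteristic polynomial to that of the reduced matrix. As N is prime to p,
  \<open>brauer_lift\<close> gives every eigenvalue back, so the sum is the ordinary trace.\<close>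

lemma brauer_trace_hom:
  fixes f :: "complex \<Rightarrow> 'f::field"
  assumes f: "subring_hom {x. algebraic_int x} f" "of_nat p = (0 :: 'f)"
    and A: "A \<in> carrier_mat n n" "\<And>i j. i < n \<Longrightarrow> j < n \<Longrightarrow> algebraic_int (A $$ (i, j))"
    and N: "N > 0" "coprime N p" "A ^\<^sub>m N = 1\<^sub>m n"
  shows "brauer_trace p f (map_mat f A) = (\<Sum>i<n. A $$ (i, i))"
proof -
  interpret subring_hom "{x. algebraic_int x}" f by fact
  obtain as where as: "char_poly A = (\<Prod>a\<leftarrow>as. [:- a, 1:])"
    using char_poly_factorized[OF A(1)] by blast
  have root: "a ^ N = 1" if "a \<in> set as" for a
  proof (rule eigenvalue_finite_order[OF A(1) N(3)])
    have "poly (char_poly A) a = 0"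
      unfolding as using that by (induction as) auto
    then show "eigenvalue A a" using eigenvalue_root_char_poly[OF A(1)] by simp
  qed
  have "set as \<subseteq> {x. algebraic_int x}"
    using root N(1) algebraic_int_root_of_unity by blast
  then have "char_poly (map_mat f A) = (\<Prod>a\<leftarrow>map f as. [:- a, 1:])"
    using hom_char_poly[OF A(1)] A(2) by (simp add: as map_poly_prod_list_linear comp_def)
  then have "brauer_trace p f (map_mat f A) = (\<Sum>a\<in>#mset (map f as). brauer_lift p f a)"
    by (simp only: brauer_trace_def proots_prod_list_linear)
  also have "\<dots> = (\<Sum>a\<leftarrow>map f as. brauer_lift p f a)"
    unfolding mset_map[symmetric] sum_mset_sum_list ..
  also have "\<dots> = sum_list (map (\<lambda>a. a) as)"
    unfolding map_map using root brauer_lift_hom[OF f N(1,2)]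
    by (intro arg_cong[of _ _ sum_list] map_cong) auto
  finally show ?thesis
    using sum_diag_eq_sum_list_roots[OF A(1) as] by simp
qed

subsection \<open>Series of exponents invariant under a permutation\<close>

text \<open>Exponents of the monomials that contribute to the trace of Sym^r. The set X is a
  parameter so that orbits of \<pi> can be removed one at a time.\<close>

definition invariant_exponents :: "('a \<Rightarrow> 'a) \<Rightarrow> 'a set \<Rightarrow> nat \<Rightarrow> ('a \<Rightarrow> nat) set" where
  "invariant_exponents \<pi> X r = {\<alpha>. (\<forall>v. v \<notin> X \<longrightarrow> \<alpha> v = 0) \<and> (\<forall>v. \<alpha> (\<pi> v) = \<alpha> v) \<and> sum \<alpha> X = r}"

text \<open>For a finite set X stable under a permutation \<pi>, this is the product of the series 1
  / (1 - z t^l) over the orbits in X.\<close>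

definition invariant_series :: "('a \<Rightarrow> 'a) \<Rightarrow> ('a \<Rightarrow> 'b::comm_ring_1) \<Rightarrow> 'a set \<Rightarrow> 'b fps" where
  "invariant_series \<pi> c X = Abs_fps (\<lambda>r. \<Sum>\<alpha>\<in>invariant_exponents \<pi> X r. \<Prod>v\<in>X. c v ^ \<alpha> v)"

lemma finite_invariant_exponents:
  assumes "finite X"
  shows "finite (invariant_exponents \<pi> X r)"
proof (rule finite_subset)
  show "invariant_exponents \<pi> X r \<subseteq> {\<alpha>. \<forall>v. (v \<in> X \<longrightarrow> \<alpha> v \<in> {..r}) \<and> (v \<notin> X \<longrightarrow> \<alpha> v = 0)}"
    using assms by (auto simp: invariant_exponents_def intro: member_le_sum)
qed (intro finite_set_of_finite_funs assms finite_atMost)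

lemma invariant_series_empty: "invariant_series \<pi> c {} = 1"
proof (rule fps_ext)
  fix r
  have "invariant_exponents \<pi> {} r = (if r = 0 then {\<lambda>_. 0} else {})"
    by (auto simp: invariant_exponents_def)
  then show "fps_nth (invariant_series \<pi> c {}) r = fps_nth 1 r"
    by (simp add: invariant_series_def)
qed

text \<open>An invariant exponent is constant on Y. Either the constant is 0, which leaves an
  exponent on X - Y, or 1 can be subtracted throughout Y, which lowers the degree by l = card Y and
  splits off \<zeta>, the product of c over Y. Hence F(X) = F(X - Y) + \<zeta> t^l F(X).\<close>

lemma orbit_factor_mult_invariant_series:
  fixes c :: "'a \<Rightarrow> 'b::comm_ring_1"
  assumes X: "finite X" and Y: "Y \<subseteq> X" "x \<in> Y"
    and inv: "\<And>v. \<pi> v \<in> Y \<longleftrightarrow> v \<in> Y"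
    and const: "\<And>(\<alpha> :: 'a \<Rightarrow> nat) v. (\<And>u. \<alpha> (\<pi> u) = \<alpha> u) \<Longrightarrow> v \<in> Y \<Longrightarrow> \<alpha> v = \<alpha> x"
  shows "(1 - fps_const (\<Prod>v\<in>Y. c v) * fps_X ^ card Y) * invariant_series \<pi> c X =
    invariant_series \<pi> c (X - Y)"
proof (rule fps_ext)
  fix r
  let ?E = "invariant_exponents \<pi>"
  define l where "l = card Y"
  define \<zeta> where "\<zeta> = (\<Prod>v\<in>Y. c v)"
  define w where "w \<alpha> = (\<Prod>v\<in>X. c v ^ \<alpha> v)" for \<alpha> :: "'a \<Rightarrow> nat"
  have finY: "finite Y" using X Y finite_subset by blast
  have split_sum: "sum \<alpha> X = sum \<alpha> (X - Y) + sum \<alpha> Y" for \<alpha> :: "'a \<Rightarrow> nat"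
    by (rule sum.subset_diff[OF Y(1) X])
  have split_prod: "w \<alpha> = (\<Prod>v\<in>X - Y. c v ^ \<alpha> v) * (\<Prod>v\<in>Y. c v ^ \<alpha> v)" for \<alpha>
    unfolding w_def by (rule prod.subset_diff[OF Y(1) X])
  have E_const: "\<alpha> v = \<alpha> x" if "\<alpha> \<in> ?E X s" "v \<in> Y" for \<alpha> v s
    using const[of \<alpha> v] that by (simp add: invariant_exponents_def)
  have sum_const: "sum \<alpha> Y = l * \<alpha> x" if "\<alpha> \<in> ?E X s" for \<alpha> s
    using E_const[OF that] by (simp add: l_def)
  have zero: "{\<alpha> \<in> ?E X r. \<alpha> x = 0} = ?E (X - Y) r"
  proof (intro equalityI subsetI)
    fix \<alpha> assume "\<alpha> \<in> {\<alpha> \<in> ?E X r. \<alpha> x = 0}"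
    then have \<alpha>: "\<alpha> \<in> ?E X r" "\<alpha> x = 0" by simp_all
    then show "\<alpha> \<in> ?E (X - Y) r"
      using sum_const[OF \<alpha>(1)] split_sum[of \<alpha>] E_const[OF \<alpha>(1)]
      by (auto simp: invariant_exponents_def)
  next
    fix \<alpha> assume \<alpha>: "\<alpha> \<in> ?E (X - Y) r"
    then have "sum \<alpha> Y = 0" by (intro sum.neutral) (auto simp: invariant_exponents_def)
    then show "\<alpha> \<in> {\<alpha> \<in> ?E X r. \<alpha> x = 0}"
      using \<alpha> Y(2) split_sum[of \<alpha>] by (auto simp: invariant_exponents_def)
  qed
  have pos: "(\<Sum>\<alpha> | \<alpha> \<in> ?E X r \<and> \<alpha> x \<noteq> 0. w \<alpha>) =
      (if l \<le> r then \<zeta> * (\<Sum>\<alpha>\<in>?E X (r - l). w \<alpha>) else 0)"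
  proof (cases "l \<le> r")
    case False
    have "l \<le> r" if "\<alpha> \<in> ?E X r" "\<alpha> x \<noteq> 0" for \<alpha>
    proof -
      have "l \<le> l * \<alpha> x" using that(2) by simp
      also have "\<dots> \<le> r"
        using sum_const[OF that(1)] split_sum[of \<alpha>] that(1) by (simp add: invariant_exponents_def)
      finally show ?thesis .
    qed
    then have empty: "{\<alpha>. \<alpha> \<in> ?E X r \<and> \<alpha> x \<noteq> 0} = {}" using False by blast
    show ?thesis unfolding empty using False by simp
  next
    case True
    define up where "up \<alpha> v = (if v \<in> Y then Suc (\<alpha> v) else \<alpha> v)" for \<alpha> :: "'a \<Rightarrow> nat" and v
    \<comment> \<open>The natural subtraction is exact: \<open>down\<close> is applied to exponents
      with \<alpha> x non-zero, hence positive on all of Y.\<close>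
    define down where "down \<alpha> v = (if v \<in> Y then \<alpha> v - 1 else \<alpha> v)" for \<alpha> :: "'a \<Rightarrow> nat" and v
    have sum_up: "sum (up \<alpha>) X = sum \<alpha> X + l" for \<alpha>
    proof -
      have "sum (up \<alpha>) (X - Y) = sum \<alpha> (X - Y)" by (rule sum.cong) (auto simp: up_def)
      moreover have "sum (up \<alpha>) Y = sum \<alpha> Y + l" by (simp add: up_def sum.distrib l_def sum_Suc)
      ultimately show ?thesis by (simp add: split_sum)
    qed
    have w_up: "w (up \<alpha>) = \<zeta> * w \<alpha>" for \<alpha>
      unfolding split_prod by (simp add: up_def prod.distrib \<zeta>_def mult_ac)
    have up: "up \<alpha> \<in> {\<alpha>. \<alpha> \<in> ?E X r \<and> \<alpha> x \<noteq> 0}" if "\<alpha> \<in> ?E X (r - l)" for \<alpha>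
    proof -
      have "sum (up \<alpha>) X = r" using that True by (simp add: sum_up invariant_exponents_def)
      moreover have "up \<alpha> v = 0" if "v \<notin> X" for v
        using that \<open>\<alpha> \<in> _\<close> Y(1) by (auto simp: up_def invariant_exponents_def)
      moreover have "up \<alpha> (\<pi> v) = up \<alpha> v" for v
        using \<open>\<alpha> \<in> _\<close> by (simp add: up_def inv invariant_exponents_def)
      ultimately show ?thesis using Y(2) by (simp add: invariant_exponents_def up_def)
    qed
    have up_down: "up (down \<alpha>) = \<alpha>" if "\<alpha> \<in> ?E X r" "\<alpha> x \<noteq> 0" for \<alpha>
      using E_const[OF that(1)] that(2) by (auto simp: up_def down_def fun_eq_iff)
    have down: "down \<alpha> \<in> ?E X (r - l)" if "\<alpha> \<in> ?E X r" "\<alpha> x \<noteq> 0" for \<alpha>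
    proof -
      have "sum (down \<alpha>) X = r - l"
        using sum_up[of "down \<alpha>"] that unfolding up_down[OF that]
        by (auto simp: invariant_exponents_def)
      moreover have "down \<alpha> v = 0" if "v \<notin> X" for v
        using that \<open>\<alpha> \<in> _\<close> by (auto simp: down_def invariant_exponents_def)
      moreover have "down \<alpha> (\<pi> v) = down \<alpha> v" for v
        using \<open>\<alpha> \<in> _\<close> by (simp add: down_def inv invariant_exponents_def)
      ultimately show ?thesis by (simp add: invariant_exponents_def)
    qed
    have "(\<Sum>\<alpha> | \<alpha> \<in> ?E X r \<and> \<alpha> x \<noteq> 0. w \<alpha>) = (\<Sum>\<alpha>\<in>?E X (r - l). w (up \<alpha>))"
    proof (rule sum.reindex_bij_witness[of _ up down])
      show "down (up \<alpha>) = \<alpha>" for \<alpha> by (auto simp: up_def down_def)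
    qed (use up down up_down in auto)
    then show ?thesis using True by (simp add: w_up sum_distrib_left)
  qed
  have "(\<Sum>\<alpha>\<in>?E X r. w \<alpha>) =
      (\<Sum>\<alpha> | \<alpha> \<in> ?E X r \<and> \<alpha> x = 0. w \<alpha>) + (\<Sum>\<alpha> | \<alpha> \<in> ?E X r \<and> \<alpha> x \<noteq> 0. w \<alpha>)"
    by (subst sum.union_disjoint[symmetric])
      (auto intro!: sum.cong finite_subset[OF _ finite_invariant_exponents[OF X]])
  also have "(\<Sum>\<alpha> | \<alpha> \<in> ?E X r \<and> \<alpha> x = 0. w \<alpha>) = (\<Sum>\<alpha>\<in>?E (X - Y) r. \<Prod>v\<in>X - Y. c v ^ \<alpha> v)"
  proof (rule sum.cong)
    fix \<alpha> assume "\<alpha> \<in> ?E (X - Y) r"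
    then have "(\<Prod>v\<in>Y. c v ^ \<alpha> v) = 1"
      by (intro prod.neutral) (auto simp: invariant_exponents_def)
    then show "w \<alpha> = (\<Prod>v\<in>X - Y. c v ^ \<alpha> v)" by (simp add: split_prod)
  qed (use zero in auto)
  finally have rec: "(\<Sum>\<alpha>\<in>?E X r. w \<alpha>) = fps_nth (invariant_series \<pi> c (X - Y)) r +
      (if l \<le> r then \<zeta> * (\<Sum>\<alpha>\<in>?E X (r - l). w \<alpha>) else 0)"
    by (simp only: pos) (simp add: invariant_series_def)
  show "fps_nth ((1 - fps_const (\<Prod>v\<in>Y. c v) * fps_X ^ card Y) * invariant_series \<pi> c X) r =
      fps_nth (invariant_series \<pi> c (X - Y)) r"
    using rec unfolding \<zeta>_def[symmetric] l_def[symmetric]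
    by (simp add: left_diff_distrib mult.assoc fps_X_power_mult_nth invariant_series_def flip: w_def)
qed

text \<open>Y collects the first l iterates of x, where l is the least period. N mod l fixes x too,
  so it is 0 by minimality. An injection of the finite set Y into itself is onto, which makes Y
  stable in both directions.\<close>

lemma funpow_orbit:
  assumes "inj \<pi>" "N > 0" "(\<pi> ^^ N) x = x"
  obtains Y where "x \<in> Y" "Y \<subseteq> range (\<lambda>i. (\<pi> ^^ i) x)" "finite Y" "card Y dvd N"
    "\<And>v. \<pi> v \<in> Y \<longleftrightarrow> v \<in> Y"
proof -
  define l where "l = (LEAST i. 0 < i \<and> (\<pi> ^^ i) x = x)"
  have l: "0 < l" "(\<pi> ^^ l) x = x"
    using LeastI[of "\<lambda>i. 0 < i \<and> (\<pi> ^^ i) x = x" N] assms(2,3) by (simp_all add: l_def)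
  have least: "(\<pi> ^^ i) x \<noteq> x" if "0 < i" "i < l" for i
    using not_less_Least[of i "\<lambda>i. 0 < i \<and> (\<pi> ^^ i) x = x"] that by (auto simp: l_def)
  define Y where "Y = (\<lambda>i. (\<pi> ^^ i) x) ` {0..<l}"
  have "card Y = l"
    unfolding Y_def using inj_on_funpow_least[OF l(2) least] by (simp add: card_image)
  have "(\<pi> ^^ (N mod l)) x = x"
    using funpow_mod_eq[OF l(2), of N] assms(3) by simp
  then have "N mod l = 0"
    using least[of "N mod l"] l(1) by (metis mod_less_divisor neq0_conv)
  then have "l dvd N" by (simp add: dvd_eq_mod_eq_0)
  have fin: "finite Y" by (simp add: Y_def)
  have mem: "(\<pi> ^^ i) x \<in> Y" if "i < l" for i
    unfolding Y_def using that by (intro imageI) simp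
  from mem[of 0] l(1) have x: "x \<in> Y" by simp
  have sub: "\<pi> ` Y \<subseteq> Y"
  proof
    fix u assume "u \<in> \<pi> ` Y"
    then obtain i where "i < l" "u = (\<pi> ^^ Suc i) x" by (auto simp: Y_def)
    then show "u \<in> Y"
      using l(2) x mem[of "Suc i"] by (cases "Suc i = l") auto
  qed
  have "\<pi> ` Y = Y"
    using fin sub assms(1) by (intro card_subset_eq) (auto simp: card_image inj_on_subset)
  then have "\<pi> v \<in> Y \<longleftrightarrow> v \<in> Y" for v
    using assms(1) by (metis inj_image_mem_iff)
  moreover have "Y \<subseteq> range (\<lambda>i. (\<pi> ^^ i) x)" by (auto simp: Y_def)
  ultimately show thesis
    using x fin \<open>card Y = l\<close> \<open>l dvd N\<close> by (intro that[of Y]) auto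
qed

text \<open>The bound s counts the points not yet removed: an orbit of length l uses up the last l
  factors and leaves the product up to s - l.\<close>

definition common_denominator :: "nat \<Rightarrow> nat \<Rightarrow> nat \<Rightarrow> complex poly" where
  "common_denominator p m s = (\<Prod>j=1..s. 1 - monom 1 (m * p'_part p j))"

subsection \<open>The common denominator\<close>

lemma degree_one_minus_monom:
  fixes a :: "'a::comm_ring_1"
  assumes "a \<noteq> 0" "l > 0"
  shows "degree (1 - monom a l) = l"
proof -
  have "degree (1 + monom (- a) l) = l"
    using assms by (subst degree_add_eq_right) (auto simp: degree_monom_eq)
  then show ?thesis by (simp flip: minus_monom)
qed

text \<open>With d = l e one has t^(m d) = (\<zeta> t^l)^(m e), because \<zeta>^m = 1; and 1 - y
  divides 1 - y^(m e).\<close>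

lemma dvd_one_minus_monom:
  assumes "\<zeta> ^ m = 1" "l dvd d"
  shows "1 - monom \<zeta> l dvd 1 - monom (1::'a::comm_ring_1) (m * d)"
proof -
  obtain e where "d = l * e" using assms(2) by blast
  moreover have "\<zeta> ^ (m * e) = 1" using assms(1) by (simp add: power_mult)
  ultimately have "monom 1 (m * d) = monom \<zeta> l ^ (m * e)"
    by (simp only: monom_power) (simp add: mult_ac)
  then show ?thesis by (simp add: one_diff_power_eq)
qed

lemma orbit_factor_dvd_common_denominator_factor:
  fixes \<zeta> :: complex
  assumes l: "l > 0" "l \<le> s" "coprime l p" and \<zeta>: "\<zeta> ^ m = 1" and "m > 0"
  obtains Q where "(\<Prod>j=Suc (s - l)..s. 1 - monom 1 (m * p'_part p j)) = (1 - monom \<zeta> l) * Q"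
    "degree Q + l \<le> (\<Sum>j=Suc (s - l)..s. m * p'_part p j)"
proof -
  let ?E = "\<Prod>j=Suc (s - l)..s. 1 - monom (1::complex) (m * p'_part p j)"
  have nz: "\<zeta> \<noteq> 0" using \<zeta> \<open>m > 0\<close> by (auto simp: power_0_left)
  \<comment> \<open>The largest multiple of l up to s; it is one of the last l indices.\<close>
  define j where "j = l * (s div l)"
  have "s - l < j" "j \<le> s"
    using mod_less_divisor[OF l(1), of s] mult_div_mod_eq[of l s] l(2) unfolding j_def by linarith+
  then have j: "j \<in> {Suc (s - l)..s}" by simp
  have "1 - monom \<zeta> l dvd 1 - monom 1 (m * p'_part p j)"
    using \<zeta> coprime_dvd_p'_part[OF l(3), of j] by (intro dvd_one_minus_monom) (auto simp: j_def)
  also have "\<dots> dvd ?E" using j by (intro dvd_prodI) auto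
  finally obtain Q where Q: "?E = (1 - monom \<zeta> l) * Q" by blast
  have deg: "degree (1 - monom (1::complex) (m * p'_part p i)) = m * p'_part p i"
    if "i \<in> {Suc (s - l)..s}" for i
    using that p'_part_pos[of i p] \<open>m > 0\<close> by (intro degree_one_minus_monom) auto
  have "1 - monom (1::complex) (m * p'_part p i) \<noteq> 0" if "i \<in> {Suc (s - l)..s}" for i
    using deg[OF that] that p'_part_pos[of i p] \<open>m > 0\<close> by auto
  then have "?E \<noteq> 0" by simp
  then have "degree ?E = l + degree Q"
    unfolding Q using nz l(1) by (subst degree_mult_eq) (auto simp: degree_one_minus_monom)
  moreover have "degree ?E \<le> (\<Sum>j=Suc (s - l)..s. degree (1 - monom (1::complex) (m * p'_part p j)))"
    using degree_prod_sum_le[of "{Suc (s - l)..s}" "\<lambda>j. 1 - monom (1::complex) (m * p'_part p j)"]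
    by simp
  moreover have "\<dots> = (\<Sum>j=Suc (s - l)..s. m * p'_part p j)"
    by (rule sum.cong[OF refl deg])
  ultimately show thesis using that[OF Q] by simp
qed

text \<open>
  Removing an orbit of length \<open>l\<close> removes a factor \<open>1 - \<zeta> t\<^sup>l\<close> from the denominator of the series.
  Among any \<open>l\<close> consecutive factors of the common denominator there is one whose index is divisible
  by \<open>l\<close>, and \<open>1 - \<zeta> t\<^sup>l\<close> divides that factor because \<open>l\<close> is prime to \<open>p\<close> and \<open>\<zeta>\<^sup>m = 1\<close>.
\<close>

lemma invariant_series_times_common_denominator:
  fixes c :: "'a \<Rightarrow> complex"
  assumes k: "k > 0" and N: "N > 0" "coprime N p" and "inj \<pi>"
    and X: "finite X" "\<And>v. \<pi> v \<in> X \<longleftrightarrow> v \<in> X"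
    and c: "\<And>v. v \<in> X \<Longrightarrow> c v ^ k = 1"
    and \<pi>N: "\<And>v. v \<in> X \<Longrightarrow> (\<pi> ^^ N) v = v"
    and cN: "\<And>v. v \<in> X \<Longrightarrow> (\<Prod>i<N. c ((\<pi> ^^ i) v)) = 1"
  defines "m \<equiv> p'_part p k"
  shows "\<exists>P. invariant_series \<pi> c X * fps_of_poly (common_denominator p m (card X)) = fps_of_poly P \<and>
    degree P + card X \<le> (\<Sum>j=1..card X. m * p'_part p j)"
  using X c \<pi>N cN
proof (induction "card X" arbitrary: X rule: less_induct)
  case less
  note X = less.prems(1,2) and c = less.prems(3) and \<pi>N = less.prems(4) and cN = less.prems(5)
  show ?case
  proof (cases "X = {}")
    case True
    then show ?thesis
      by (intro exI[of _ 1]) (simp add: invariant_series_empty common_denominator_def)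
  next
    case False
    then obtain x where x: "x \<in> X" by blast
    obtain Y where Y: "x \<in> Y" "Y \<subseteq> range (\<lambda>i. (\<pi> ^^ i) x)" "finite Y" "card Y dvd N"
      "\<And>v. \<pi> v \<in> Y \<longleftrightarrow> v \<in> Y"
      using funpow_orbit[OF \<open>inj \<pi>\<close> N(1) \<pi>N[OF x]] by blast
    define s l where "s = card X" and "l = card Y"
    define \<zeta> where "\<zeta> = (\<Prod>v\<in>Y. c v)"
    have "(\<pi> ^^ i) x \<in> X" for i using x X(2) by (induction i) auto
    then have YX: "Y \<subseteq> X" using Y(2) by auto
    have l: "l > 0" "l \<le> s" "coprime l p"
      using Y(1,3,4) card_mono[OF X(1) YX] N(2)
      by (auto simp: l_def s_def card_gt_0_iff intro: coprime_imp_coprime dvd_trans)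
    have const: "\<alpha> v = \<alpha> x" if "\<And>u. \<alpha> (\<pi> u) = \<alpha> u" "v \<in> Y" for \<alpha> :: "'a \<Rightarrow> nat" and v
    proof -
      have "\<alpha> ((\<pi> ^^ i) x) = \<alpha> x" for i by (induction i) (auto simp: that(1))
      then show ?thesis using Y(2) that(2) by auto
    qed
    \<comment> \<open>Iterates of \<pi> permute Y, so the i-th copy of \<zeta> may be written with
      arguments shifted by the i-th iterate. After exchanging the products, \<open>cN\<close>
      applies at each point of Y.\<close>
    have "\<zeta> ^ N = (\<Prod>i<N. \<Prod>v\<in>Y. c ((\<pi> ^^ i) v))"
    proof -
      have "(\<Prod>v\<in>Y. c ((\<pi> ^^ i) v)) = \<zeta>" for i
      proof -
        have inj: "inj_on (\<pi> ^^ i) Y" using inj_fn[OF \<open>inj \<pi>\<close>, of i] by (rule inj_on_subset) simp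
        have "(\<pi> ^^ i) v \<in> Y \<longleftrightarrow> v \<in> Y" for v by (induction i) (auto simp: Y(5))
        then have "(\<pi> ^^ i) ` Y = Y" using inj Y(3) by (intro endo_inj_surj) auto
        with inj show ?thesis
          unfolding \<zeta>_def by (metis (no_types, lifting) prod.reindex_cong)
      qed
      then show ?thesis by simp
    qed
    also have "\<dots> = (\<Prod>v\<in>Y. \<Prod>i<N. c ((\<pi> ^^ i) v))" by (rule prod.swap)
    also have "\<dots> = 1" using cN YX by (intro prod.neutral) auto
    finally have "\<zeta> ^ N = 1" .
    moreover have "\<zeta> ^ k = 1"
      unfolding \<zeta>_def prod_power_distrib using c YX by (intro prod.neutral) auto
    ultimately have \<zeta>: "\<zeta> ^ m = 1"
      unfolding m_def using N by (intro power_p'_part_eq_1) auto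
    have "m > 0" using k by (simp add: m_def p'_part_pos)
    then obtain Q where Q:
      "(\<Prod>j=Suc (s - l)..s. 1 - monom 1 (m * p'_part p j)) = (1 - monom \<zeta> l) * Q"
      "degree Q + l \<le> (\<Sum>j=Suc (s - l)..s. m * p'_part p j)"
      using orbit_factor_dvd_common_denominator_factor[OF l \<zeta>] by blast
    have card: "card (X - Y) = s - l" using Y(3) YX by (simp add: card_Diff_subset s_def l_def)
    obtain P where P: "invariant_series \<pi> c (X - Y) *
        fps_of_poly (common_denominator p m (s - l)) = fps_of_poly P"
      "degree P + (s - l) \<le> (\<Sum>j=1..s - l. m * p'_part p j)"
      using less.hyps[of "X - Y"] X Y(5) c \<pi>N cN l unfolding card s_def[symmetric] by auto
    have split: "{1..s} = {1..s - l} \<union> {Suc (s - l)..s}" using l by auto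
    have "common_denominator p m s = common_denominator p m (s - l) * ((1 - monom \<zeta> l) * Q)"
      unfolding common_denominator_def Q(1)[symmetric] split by (rule prod.union_disjoint) auto
    then have "invariant_series \<pi> c X * fps_of_poly (common_denominator p m s) =
        ((1 - fps_const \<zeta> * fps_X ^ l) * invariant_series \<pi> c X) *
        fps_of_poly (common_denominator p m (s - l)) * fps_of_poly Q"
      by (simp add: fps_of_poly_mult fps_of_poly_diff fps_of_poly_monom mult_ac)
    also have "(1 - fps_const \<zeta> * fps_X ^ l) * invariant_series \<pi> c X = invariant_series \<pi> c (X - Y)"
      unfolding \<zeta>_def l_def using X(1) YX Y(1,5) const by (rule orbit_factor_mult_invariant_series)
    finally have "invariant_series \<pi> c X * fps_of_poly (common_denominator p m s) = fps_of_poly (P * Q)"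
      by (simp add: P(1) fps_of_poly_mult)
    \<comment> \<open>Q falls short of the degree available in its block by at least the orbit
      length l; over all orbits these deficits add up to card X.\<close>
    moreover have "degree (P * Q) + s \<le> (\<Sum>j=1..s. m * p'_part p j)"
    proof -
      have "(\<Sum>j=1..s. m * p'_part p j) =
          (\<Sum>j=1..s - l. m * p'_part p j) + (\<Sum>j=Suc (s - l)..s. m * p'_part p j)"
        unfolding split by (rule sum.union_disjoint) auto
      then show ?thesis using degree_mult_le[of P Q] P(2) Q(2) l(2) by linarith
    qed
    ultimately show ?thesis unfolding s_def by blast
  qed
qed

section \<open>Brauer characters of symmetric powers as rational series\<close>

lemma trace_sym_power_monomial_mat:
  fixes c :: "nat \<Rightarrow> 'a::comm_ring_1"
  assumes \<pi>: "\<pi> permutes {..<n}"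
  shows "(\<Sum>i<card (monomials n r). sym_power_mat r (monomial_mat n \<pi> c) $$ (i, i)) =
    fps_nth (invariant_series \<pi> c {..<n}) r"
proof -
  let ?ms = "sorted_list_of_set (monomials n r)"
  let ?w = "\<lambda>\<alpha>. \<Prod>v<n. c v ^ \<alpha> v"
  have "(\<Sum>i<card (monomials n r). sym_power_mat r (monomial_mat n \<pi> c) $$ (i, i)) =
      (\<Sum>i<card (monomials n r). if Poly_Mapping.map_key \<pi> (?ms ! i) = ?ms ! i
        then ?w (Poly_Mapping.lookup (?ms ! i)) else 0)"
    by (intro sum.cong) (auto simp: index_sym_power_monomial_mat[OF \<pi>])
  also have "\<dots> = (\<Sum>\<alpha>\<in>monomials n r. if Poly_Mapping.map_key \<pi> \<alpha> = \<alpha>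
      then ?w (Poly_Mapping.lookup \<alpha>) else 0)"
    using bij_betw_nth[of ?ms "{..<card (monomials n r)}" "monomials n r"]
    by (intro sum.reindex_bij_betw) (simp add: finite_monomials)
  also have "\<dots> = (\<Sum>\<alpha> | \<alpha> \<in> monomials n r \<and> Poly_Mapping.map_key \<pi> \<alpha> = \<alpha>. ?w (Poly_Mapping.lookup \<alpha>))"
    by (intro sum.mono_neutral_cong_right) (auto simp: finite_monomials)
  \<comment> \<open>\<open>Abs_poly_mapping\<close> inverts \<open>lookup\<close> here because these
    functions vanish outside {..<n} and so have finite support.\<close>
  also have "\<dots> = (\<Sum>\<alpha>\<in>invariant_exponents \<pi> {..<n} r. ?w \<alpha>)"
  proof (rule sum.reindex_bij_witness[of _ Poly_Mapping.Abs_poly_mapping Poly_Mapping.lookup])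
    fix \<alpha> :: "nat \<Rightarrow>\<^sub>0 nat" assume "\<alpha> \<in> {\<alpha>. \<alpha> \<in> monomials n r \<and> Poly_Mapping.map_key \<pi> \<alpha> = \<alpha>}"
    then have \<alpha>: "\<alpha> \<in> monomials n r" and fixed: "Poly_Mapping.map_key \<pi> \<alpha> = \<alpha>" by simp_all
    have "Poly_Mapping.lookup \<alpha> (\<pi> v) = Poly_Mapping.lookup \<alpha> v" for v
      using lookup_map_key_permutes[OF \<pi>, of \<alpha> v] fixed by simp
    then show "Poly_Mapping.lookup \<alpha> \<in> invariant_exponents \<pi> {..<n} r"
      using \<alpha> monomials_lookup_eq_0[OF \<alpha>] by (auto simp: invariant_exponents_def monomials_def)
  next
    fix \<alpha> assume \<alpha>: "\<alpha> \<in> invariant_exponents \<pi> {..<n} r"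
    then have "{v. \<alpha> v \<noteq> 0} \<subseteq> {..<n}" by (auto simp: invariant_exponents_def)
    then have "finite {v. \<alpha> v \<noteq> 0}" by (rule finite_subset) simp
    then show lookup: "Poly_Mapping.lookup (Poly_Mapping.Abs_poly_mapping \<alpha>) = \<alpha>"
      by (simp add: Abs_poly_mapping_inverse)
    show "Poly_Mapping.Abs_poly_mapping \<alpha> \<in> {\<alpha>. \<alpha> \<in> monomials n r \<and> Poly_Mapping.map_key \<pi> \<alpha> = \<alpha>}"
      using \<alpha> by (auto simp: monomials_def in_keys_iff lookup invariant_exponents_def
        lookup_map_key_permutes[OF \<pi>] not_less intro!: poly_mapping_eqI)
        (metis leI less_irrefl)
  qed (auto simp: lookup_inverse)
  finally show ?thesis by (simp add: invariant_series_def)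
qed

text \<open>Reduction commutes with Sym^r on monomial matrices, and Sym^r g has algebraic integer
  entries and N-th power 1. So its Brauer trace is the ordinary trace, to which only monomials fixed
  by \<pi> contribute.\<close>

lemma sym_brauer_char_monomial_mat:
  fixes f :: "complex \<Rightarrow> 'f::field"
  assumes f: "subring_hom {x. algebraic_int x} f" "of_nat p = (0 :: 'f)"
    and \<pi>: "\<pi> permutes {..<n}" and c: "\<And>v. v < n \<Longrightarrow> algebraic_int (c v)"
    and N: "N > 0" "coprime N p" "monomial_mat n \<pi> c ^\<^sub>m N = 1\<^sub>m n"
    and reg: "monomial_mat n \<pi> c \<in> p_regular p (gen_sym_group k n)"
  shows "sym_brauer_char p f n k r (monomial_mat n \<pi> c) = fps_nth (invariant_series \<pi> c {..<n}) r"
proof -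
  interpret subring_hom "{x. algebraic_int x}" f by fact
  let ?S = "sym_power_mat r (monomial_mat n \<pi> c)"
  have prod: "(\<Prod>v<n. c v ^ \<alpha> v) \<in> {x. algebraic_int x}"
    "f (\<Prod>v<n. c v ^ \<alpha> v) = (\<Prod>v<n. f (c v) ^ \<alpha> v)" for \<alpha>
  proof -
    have "c v ^ \<alpha> v \<in> {x. algebraic_int x}" if "v \<in> {..<n}" for v
      by (rule power_closed) (use c that in simp)
    note mem = this
    show "(\<Prod>v<n. c v ^ \<alpha> v) \<in> {x. algebraic_int x}"
      using mem by (rule prod_closed)
    have "f (\<Prod>v<n. c v ^ \<alpha> v) = (\<Prod>v<n. f (c v ^ \<alpha> v))"
      using mem by (rule hom_prod)
    also have "\<dots> = (\<Prod>v<n. f (c v) ^ \<alpha> v)"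
      using c by (intro prod.cong) (auto simp: hom_power)
    finally show "f (\<Prod>v<n. c v ^ \<alpha> v) = (\<Prod>v<n. f (c v) ^ \<alpha> v)" .
  qed
  have "sym_brauer_char p f n k r (monomial_mat n \<pi> c) = brauer_trace p f (map_mat f ?S)"
    using reg by (simp add: sym_brauer_char_def map_mat_sym_power_monomial_mat[OF \<pi> hom_zero prod(2)])
  also have "\<dots> = (\<Sum>i<card (monomials n r). ?S $$ (i, i))"
  proof (rule brauer_trace_hom[OF f _ _ N(1,2)])
    show "?S \<in> carrier_mat (card (monomials n r)) (card (monomials n r))"
      by (rule carrier_matI) simp_all
    show "algebraic_int (?S $$ (i, j))" if "i < card (monomials n r)" "j < card (monomials n r)" for i j
      using prod(1) that by (simp add: index_sym_power_monomial_mat[OF \<pi>])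
    show "?S ^\<^sub>m N = 1\<^sub>m (card (monomials n r))"
      using sym_power_monomial_mat_pow[OF \<pi>, of r c N] by (simp add: N(3) sym_power_mat_one)
  qed
  finally show ?thesis by (simp add: trace_sym_power_monomial_mat[OF \<pi>])
qed

lemma sym_brauer_char_rational:
  fixes f :: "complex \<Rightarrow> 'f::field"
  assumes f: "subring_hom {x. algebraic_int x} f" "of_nat p = (0 :: 'f)"
    and p: "prime p" and k: "k \<ge> 1" and g: "g \<in> p_regular p (gen_sym_group k n)"
  defines "m \<equiv> p'_part p k"
  shows "\<exists>P. Abs_fps (\<lambda>r. sym_brauer_char p f n k r g) * fps_of_poly (common_denominator p m n) =
    fps_of_poly P \<and> degree P + n \<le> (\<Sum>j=1..n. m * p'_part p j)"
proof -
  obtain \<pi> c N where \<pi>: "\<pi> permutes {..<n}" and c: "\<And>j. j < n \<Longrightarrow> c j ^ k = 1"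
    and g_eq: "g = monomial_mat n \<pi> c" and N: "coprime N p" "g ^\<^sub>m N = 1\<^sub>m n"
    using p_regular_gen_sym_group_cases[OF k g] by metis
  \<comment> \<open>N stands for \<open>ord g\<close>, which would be 0 for infinite order;
    coprimality to the prime p excludes that.\<close>
  have "N > 0" using N(1) p by (cases N) auto
  have "algebraic_int (c v)" if "v < n" for v
    using algebraic_int_root_of_unity[of k "c v"] c[OF that] k by simp
  then have "Abs_fps (\<lambda>r. sym_brauer_char p f n k r g) = invariant_series \<pi> c {..<n}"
    using sym_brauer_char_monomial_mat[OF f \<pi> _ \<open>N > 0\<close> N(1)] N(2) g
    unfolding g_eq by (intro fps_ext) simp
  moreover have "monomial_mat n (\<pi> ^^ N) (\<lambda>j. \<Prod>i<N. c ((\<pi> ^^ i) j)) = 1\<^sub>m n"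
    using N(2) by (simp add: g_eq monomial_mat_pow[OF \<pi>])
  note one = monomial_mat_eq_oneD[OF this]
  have "\<exists>P. invariant_series \<pi> c {..<n} *
      fps_of_poly (common_denominator p (p'_part p k) (card {..<n})) = fps_of_poly P \<and>
    degree P + card {..<n} \<le> (\<Sum>j=1..card {..<n}. p'_part p k * p'_part p j)"
    by (rule invariant_series_times_common_denominator[OF _ \<open>N > 0\<close> N(1)])
      (use k \<pi> c one permutes_inj in auto)
  ultimately show ?thesis by (simp add: m_def)
qed

section \<open>The dimension bound\<close>

lemma sum_fun_apply:
  fixes f :: "'i \<Rightarrow> 'a \<Rightarrow> 'b::comm_monoid_add"
  shows "(\<Sum>i\<in>A. f i) x = (\<Sum>i\<in>A. f i x)"
  by (induction A rule: infinite_finite_induct) auto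

lemma vector_space_complex_fun: "vector_space (\<lambda>(c::complex) f (x::'a). c * f x)"
  by unfold_locales (auto simp: fun_eq_iff algebra_simps)

lemma B_dim_le:
  fixes f :: "complex \<Rightarrow> 'f::field"
  assumes f: "subring_hom {x. algebraic_int x} f" "of_nat p = (0 :: 'f)"
    and p: "prime p" and k: "k \<ge> 1"
  defines "m \<equiv> p'_part p k"
  shows "B_dim p f n k + n \<le> m * (\<Sum>j=1..n. p'_part p j) + 1"
proof -
  \<comment> \<open>A bound for the degrees of all numerators. The natural subtraction is exact
    because each of the n summands is at least 1.\<close>
  define K where "K = (\<Sum>j=1..n. m * p'_part p j) - n"
  define D where "D = fps_of_poly (common_denominator p m n)"
  let ?reg = "p_regular p (gen_sym_group k n)"
  let ?\<chi> = "sym_brauer_char p f n k"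
  interpret vector_space "\<lambda>(c::complex) f (x::complex mat). c * f x"
    by (rule vector_space_complex_fun)
  have "\<forall>g\<in>?reg. \<exists>P. Abs_fps (\<lambda>r. ?\<chi> r g) * D = fps_of_poly P \<and>
      degree P + n \<le> (\<Sum>j=1..n. m * p'_part p j)"
    unfolding D_def m_def by (intro ballI sym_brauer_char_rational[OF f p k])
  then obtain P where P': "\<forall>g\<in>?reg. Abs_fps (\<lambda>r. ?\<chi> r g) * D = fps_of_poly (P g) \<and>
      degree (P g) + n \<le> (\<Sum>j=1..n. m * p'_part p j)"
    by (rule bchoice[THEN exE])
  have P: "Abs_fps (\<lambda>r. ?\<chi> r g) * D = fps_of_poly (P g)"
    "degree (P g) + n \<le> (\<Sum>j=1..n. m * p'_part p j)" if "g \<in> ?reg" for g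
    using bspec[OF P' that] by (rule conjunct1, rule conjunct2)
  have "m > 0" using k by (simp add: m_def p'_part_pos)
  have "n \<le> (\<Sum>j=1..n. m * p'_part p j)"
  proof -
    have "(\<Sum>j=1..n. 1) \<le> (\<Sum>j=1..n. m * p'_part p j)"
      using p'_part_pos \<open>m > 0\<close> by (intro sum_mono) (simp add: Suc_leI)
    then show ?thesis by simp
  qed
  then have K: "K + n = m * (\<Sum>j=1..n. p'_part p j)"
    by (simp add: K_def sum_distrib_left)
  have "fps_nth D 0 \<noteq> 0"
  proof -
    have "coeff (common_denominator p m n) 0 = (\<Prod>j=1..n. 1)"
      unfolding common_denominator_def poly_0_coeff_0[symmetric] poly_prod
      using p'_part_pos \<open>m > 0\<close> by (intro prod.cong) (auto simp: poly_monom power_0_left)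
    then show ?thesis by (simp add: D_def)
  qed
  then have inv: "D * inverse D = 1" by (rule inverse_mult_eq_1')
  \<comment> \<open>\<open>B i\<close> does not involve r, and \<open>b i r\<close> does not involve
    g. This separation puts all characters into the span of the K + 1 functions \<open>B i\<close>,
    which are extended by zero like the characters themselves.\<close>
  define B where "B i g = (if g \<in> ?reg then coeff (P g) i else 0)" for i g
  define b where "b i r = (if i \<le> r then fps_nth (inverse D) (r - i) else 0)" for i r
  have \<chi>: "?\<chi> r = (\<Sum>i\<le>K. (\<lambda>g. b i r * B i g))" for r
  proof (rule ext)
    fix g
    show "?\<chi> r g = (\<Sum>i\<le>K. (\<lambda>g. b i r * B i g)) g"
    proof (cases "g \<in> ?reg")
      case False
      then show ?thesis by (simp add: sym_brauer_char_def B_def sum_fun_apply)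
    next
      case True
      have "Abs_fps (\<lambda>r. ?\<chi> r g) = fps_of_poly (P g) * inverse D"
        unfolding P(1)[OF True, symmetric] by (simp add: mult.assoc inv)
      then have "?\<chi> r g = fps_nth (fps_of_poly (P g) * inverse D) r"
        by (metis fps_nth_Abs_fps)
      also have "\<dots> = (\<Sum>i\<le>r. coeff (P g) i * fps_nth (inverse D) (r - i))"
        by (simp add: fps_mult_nth atLeast0AtMost)
      \<comment> \<open>Both ranges of summation are compared with the larger one:
        \<open>b i r\<close> vanishes for i > r, and the i-th coefficient of \<open>P g\<close> for
        i > K.\<close>
      also have "\<dots> = (\<Sum>i\<le>max r K. b i r * B i g)"
        by (rule sum.mono_neutral_cong_left) (auto simp: b_def B_def True)
      also have "\<dots> = (\<Sum>i\<le>K. b i r * B i g)"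
      proof (rule sum.mono_neutral_right)
        show "\<forall>i\<in>{..max r K} - {..K}. b i r * B i g = 0"
          using P(2)[OF True] K by (auto simp: B_def K_def intro!: coeff_eq_0)
      qed auto
      finally show ?thesis by (simp add: sum_fun_apply)
    qed
  qed
  have scaled: "(\<lambda>g. b i r * B i g) \<in> span (B ` {..K})" if "i \<in> {..K}" for i r
    using span_base[of "B i" "B ` {..K}"] that by (intro span_scale) simp
  have "range ?\<chi> \<subseteq> span (B ` {..K})"
    by (rule image_subsetI) (unfold \<chi>, intro span_sum scaled)
  then have "B_dim p f n k \<le> card (B ` {..K})"
    unfolding B_dim_def by (rule dim_le_card) simp
  also have "\<dots> \<le> K + 1" using card_image_le[of "{..K}" B] by simp
  finally show ?thesis using K by simp
qed

theorem proposition15: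
  fixes p n k :: nat and M :: "complex set" and \<phi> :: "complex set \<Rightarrow> 'f::field"
  assumes "prime p" and "n \<ge> 1" and "k \<ge> 1"
    and "maximalideal M alg_ints" and "of_nat p \<in> M"
    and "\<phi> \<in> ring_iso (alg_ints Quot M) class_ring"
  shows "real (B_dim p (reduction M \<phi>) n k) \<le>
    real (p'_part p k) *
      (real p / (2 * real p + 2) * real n ^ 2 + real n * (log (real p) (real n) + 1))
    - real n + 1"
proof -
  interpret subring_hom "{x. algebraic_int x}" "reduction M \<phi>"
    using assms(4,6) by (rule subring_hom_reduction)
  \<comment> \<open>Together with p in M this shows that p vanishes in the residue field.\<close>
  have "reduction M \<phi> (of_nat j) = of_nat j" for j
    by (induction j) (simp_all add: hom_zero hom_one hom_add)
  then have "of_nat p = (0 :: 'f)"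
    using reduction_eq_0[OF assms(4,6,5)] by simp
  then have "B_dim p (reduction M \<phi>) n k + n \<le> p'_part p k * (\<Sum>j=1..n. p'_part p j) + 1"
    using subring_hom_axioms assms(1,3) by (intro B_dim_le)
  then have "real (B_dim p (reduction M \<phi>) n k + n) \<le> real (p'_part p k * (\<Sum>j=1..n. p'_part p j) + 1)"
    by (simp only: of_nat_le_iff)
  moreover have "real (p'_part p k) * (\<Sum>j=1..n. real (p'_part p j)) \<le> real (p'_part p k) *
      (real p / (2 * real p + 2) * real n ^ 2 + real n * (log (real p) (real n) + 1))"
    using sum_p'_part_le[OF assms(1,2)] by (intro mult_left_mono) auto
  ultimately show ?thesis by simp
qed

end
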